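(* There exists no *-homomorphism $\Pi:\mathfrak A\to\widehat{\mathfrak A}_1$ such that $\Pi(\sigma_-^{(x)})=a_x$ for at least two different $x\in\mathbb Z$.
   Context: Spin algebra. $\mathrm{Fin}(\mathbb Z)$ is the set of nonempty finite subsets of $\mathbb Z$, directed by inclusion. For each $x\in\mathbb Z$, $\mathfrak A_x$ is a unital C*-algebra with identity $1_{\{x\}}$ and a fixed *-isomorphism $\xi_x:\mathfrak A_x\to\mathbb C^{2\times2}$. For $\Lambda=\{x_1<\dots<x_n\}\in\mathrm{Fin}(\mathbb Z)$, $\mathfrak A_\Lambda=\mathfrak A_{x_1}\odot\cdots\odot\mathfrak A_{x_n}$ is the algebraic tensor product with factorwise multiplication and involution and its unique C*-norm (so $\mathfrak A_\Lambda\cong\mathbb C^{2^n\times2^n}$). For $\Lambda\subseteq\Lambda'$, $\varphi_{\Lambda',\Lambda}:\mathfrak A_\Lambda\to\mathfrak A_{\Lambda'}$ is the unital injective *-homomorphism inserting $1_{\{x\}}$ in the tensor slots $x\in\Lambda'\setminus\Lambda$. $\mathfrak A$ is the infinite tensor product, i.e., the C*-inductive limit of $(\mathfrak A_\Lambda,\varphi_{\Lambda',\Lambda})$: a unital C*-algebra with unital C*-subalgebras $\widetilde{\mathfrak A}_\Lambda$ and *-isomorphisms $\varphi_\Lambda:\mathfrak A_\Lambda\to\widetilde{\mathfrak A}_\Lambda$ such that $\varphi_{\Lambda'}\circ\varphi_{\Lambda',\Lambda}=\varphi_\Lambda$ for $\Lambda\subseteq\Lambda'$ and $\bigcup_\Lambda\widetilde{\mathfrak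 A}_\Lambda$ is dense in $\mathfrak A$. Spins. $\sigma_1,\sigma_2,\sigma_3$ are the Pauli matrices, $\sigma_0=1_2$, and $\sigma_\kappa^{(x)}:=\varphi_{\{x\}}(\xi_x^{-1}(\sigma_\kappa))\in\mathfrak A$ for $x\in\mathbb Z$, $\kappa\in\{0,1,2,3\}$. $\sigma_\pm^{(x)}:=\frac12(\sigma_1^{(x)}\pm i\sigma_2^{(x)})$. $S_x:=\prod_{y=1}^{x-1}\sigma_3^{(y)}$ if $x\ge2$, $S_1:=1$, $S_x:=\prod_{y=x}^{0}\sigma_3^{(y)}$ if $x\le0$. $\Theta'$ is the *-automorphism of $\mathfrak A$ with $\Theta'(\sigma_\kappa^{(x)})=\sigma_\kappa^{(x)}$ if $x\ge1$ and $\Theta'(\sigma_\kappa^{(x)})=\varepsilon_\kappa\sigma_\kappa^{(x)}$ if $x\le0$, where $\varepsilon_0=\varepsilon_3=1$, $\varepsilon_1=\varepsilon_2=-1$; it satisfies $\Theta'^2=1$. Extension. $\widehat{\mathfrak A}:=\left\{\begin{bmatrix}A&B\\\Theta'(B)&\Theta'(A)\end{bmatrix}:A,B\in\mathfrak A\right\}$, a unital C*-subalgebra of the C*-algebra $\mathfrak A^{2\times2}$ of $2\times2$ matrices over $\mathfrak A$; $\psi(A):=\begin{bmatrix}A&0\\0&\Theta'(A)\end{bmatrix}$ for $A\in\mathfrak A$; $T:=\begin{bmatrix}0&1\\1&0\end{bmatrix}$; $a_x:=T\psi(S_x\sigma_-^{(x)})\in\widehat{\mathfrak A}$ for $x\in\mathbb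 Z$. $\widehat{\mathfrak A}_1$ is the C*-subalgebra of $\widehat{\mathfrak A}$ generated by $\{a_x:x\in\mathbb Z\}$. A *-homomorphism is a linear map preserving multiplication and involution (not required to be unital). *)

theory Defs
  imports
    "HOL-Analysis.Analysis"
    "HOL-Algebra.Module"
    "HOL-Library.Poly_Mapping"
begin

section \<open>C*-algebras\<close>

definition complex_ring :: "complex ring" where
  "complex_ring = \<lparr>carrier = UNIV, mult = (*), one = 1, zero = 0, add = (+)\<rparr>"

record 'a cstar = "(complex, 'a) module" +
  adj :: "'a \<Rightarrow> 'a"
  cnorm :: "'a \<Rightarrow> real"

locale cstar_algebra = ring A + module complex_ring A for A :: "'a cstar" (structure) +
  assumes smult_mult_left:
      "\<lbrakk>a \<in> carrier A; b \<in> carrier A\<rbrakk> \<Longrightarrow> (c \<odot> a) \<otimes> b = c \<odot> (a \<otimes> b)"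
    and smult_mult_right:
      "\<lbrakk>a \<in> carrier A; b \<in> carrier A\<rbrakk> \<Longrightarrow> a \<otimes> (c \<odot> b) = c \<odot> (a \<otimes> b)"
    and adj_closed: "a \<in> carrier A \<Longrightarrow> adj A a \<in> carrier A"
    and adj_adj: "a \<in> carrier A \<Longrightarrow> adj A (adj A a) = a"
    and adj_add:
      "\<lbrakk>a \<in> carrier A; b \<in> carrier A\<rbrakk> \<Longrightarrow> adj A (a \<oplus> b) = adj A a \<oplus> adj A b"
    and adj_smult: "a \<in> carrier A \<Longrightarrow> adj A (c \<odot> a) = cnj c \<odot> adj A a"
    and adj_mult:
      "\<lbrakk>a \<in> carrier A; b \<in> carrier A\<rbrakk> \<Longrightarrow> adj A (a \<otimes> b) = adj A b \<otimes> adj A a"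
    and cnorm_nonneg: "a \<in> carrier A \<Longrightarrow> 0 \<le> cnorm A a"
    and cnorm_eq_0_iff: "a \<in> carrier A \<Longrightarrow> cnorm A a = 0 \<longleftrightarrow> a = \<zero>"
    and cnorm_triangle:
      "\<lbrakk>a \<in> carrier A; b \<in> carrier A\<rbrakk> \<Longrightarrow> cnorm A (a \<oplus> b) \<le> cnorm A a + cnorm A b"
    and cnorm_smult: "a \<in> carrier A \<Longrightarrow> cnorm A (c \<odot> a) = cmod c * cnorm A a"
    and cnorm_mult_le:
      "\<lbrakk>a \<in> carrier A; b \<in> carrier A\<rbrakk> \<Longrightarrow> cnorm A (a \<otimes> b) \<le> cnorm A a * cnorm A b"
    and cstar_identity: "a \<in> carrier A \<Longrightarrow> cnorm A (adj A a \<otimes> a) = (cnorm A a)\<^sup>2"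
    and complete:
      "\<lbrakk>\<And>n. s n \<in> carrier A;
        \<And>e. e > 0 \<Longrightarrow> \<exists>N. \<forall>m\<ge>N. \<forall>n\<ge>N. cnorm A (s m \<ominus> s n) < e\<rbrakk>
       \<Longrightarrow> \<exists>l\<in>carrier A. (\<lambda>n. cnorm A (s n \<ominus> l)) \<longlonglongrightarrow> 0"

definition star_hom :: "'a cstar \<Rightarrow> 'b cstar \<Rightarrow> ('a \<Rightarrow> 'b) \<Rightarrow> bool" where
  "star_hom A B h \<longleftrightarrow>
     h \<in> carrier A \<rightarrow> carrier B \<and>
     (\<forall>a\<in>carrier A. \<forall>b\<in>carrier A. h (a \<oplus>\<^bsub>A\<^esub> b) = h a \<oplus>\<^bsub>B\<^esub> h b) \<and>
     (\<forall>c. \<forall>a\<in>carrier A. h (c \<odot>\<^bsub>A\<^esub> a) = c \<odot>\<^bsub>B\<^esub> h a) \<and>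
     (\<forall>a\<in>carrier A. \<forall>b\<in>carrier A. h (a \<otimes>\<^bsub>A\<^esub> b) = h a \<otimes>\<^bsub>B\<^esub> h b) \<and>
     (\<forall>a\<in>carrier A. h (adj A a) = adj B (h a))"

definition star_iso :: "'a cstar \<Rightarrow> 'b cstar \<Rightarrow> ('a \<Rightarrow> 'b) \<Rightarrow> bool" where
  "star_iso A B h \<longleftrightarrow> star_hom A B h \<and> bij_betw h (carrier A) (carrier B)"

definition cstar_subalgebra :: "'a set \<Rightarrow> 'a cstar \<Rightarrow> bool" where
  "cstar_subalgebra B A \<longleftrightarrow>
     B \<subseteq> carrier A \<and>
     \<zero>\<^bsub>A\<^esub> \<in> B \<and>
     (\<forall>a\<in>B. \<forall>b\<in>B. a \<oplus>\<^bsub>A\<^esub> b \<in> B \<and> a \<otimes>\<^bsub>A\<^esub> b \<in> B) \<and>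
     (\<forall>c. \<forall>a\<in>B. c \<odot>\<^bsub>A\<^esub> a \<in> B) \<and>
     (\<forall>a\<in>B. adj A a \<in> B) \<and>
     (\<forall>s. \<forall>l\<in>carrier A.
        (\<forall>n::nat. s n \<in> B) \<and> (\<lambda>n. cnorm A (s n \<ominus>\<^bsub>A\<^esub> l)) \<longlonglongrightarrow> 0 \<longrightarrow> l \<in> B)"

definition cstar_generated :: "'a cstar \<Rightarrow> 'a set \<Rightarrow> 'a set" where
  "cstar_generated A X = \<Inter> {B. cstar_subalgebra B A \<and> X \<subseteq> B}"

text \<open>
  A unital *-algebra carries at most one norm making it a C*-algebra. This replaces the
  norm component of a record by that norm (extended by 0 off the carrier).
\<close>

definition with_cstar_norm :: "'a cstar \<Rightarrow> 'a cstar" where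
  "with_cstar_norm A =
     A\<lparr>cnorm := (THE n. cstar_algebra (A\<lparr>cnorm := n\<rparr>) \<and> (\<forall>a. a \<notin> carrier A \<longrightarrow> n a = 0))\<rparr>"


section \<open>Two-by-two matrices\<close>

definition mat2 :: "'a \<Rightarrow> 'a \<Rightarrow> 'a \<Rightarrow> 'a \<Rightarrow> 'a ^ 2 ^ 2" where
  "mat2 a b c d = (\<chi> i j. if i = 1 then (if j = 1 then a else b) else (if j = 1 then c else d))"

definition complex_mat2 :: "(complex ^ 2 ^ 2) cstar" where
  "complex_mat2 =
     \<lparr>carrier = UNIV, mult = (**), one = mat 1, zero = 0, add = (+),
      smult = (\<lambda>c M. \<chi> i j. c * M $ i $ j),
      adj = (\<lambda>M. \<chi> i j. cnj (M $ j $ i)),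
      cnorm = (\<lambda>M. onorm ((*v) M))\<rparr>"

definition mat2_over :: "'a cstar \<Rightarrow> ('a ^ 2 ^ 2) cstar" where
  "mat2_over A = with_cstar_norm
     \<lparr>carrier = {M. \<forall>i j. M $ i $ j \<in> carrier A},
      mult = (\<lambda>M N. \<chi> i j. M $ i $ 1 \<otimes>\<^bsub>A\<^esub> N $ 1 $ j \<oplus>\<^bsub>A\<^esub> M $ i $ 2 \<otimes>\<^bsub>A\<^esub> N $ 2 $ j),
      one = mat2 \<one>\<^bsub>A\<^esub> \<zero>\<^bsub>A\<^esub> \<zero>\<^bsub>A\<^esub> \<one>\<^bsub>A\<^esub>,
      zero = mat2 \<zero>\<^bsub>A\<^esub> \<zero>\<^bsub>A\<^esub> \<zero>\<^bsub>A\<^esub> \<zero>\<^bsub>A\<^esub>,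
      add = (\<lambda>M N. \<chi> i j. M $ i $ j \<oplus>\<^bsub>A\<^esub> N $ i $ j),
      smult = (\<lambda>c M. \<chi> i j. c \<odot>\<^bsub>A\<^esub> M $ i $ j),
      adj = (\<lambda>M. \<chi> i j. adj A (M $ j $ i)),
      cnorm = (\<lambda>_. 0)\<rparr>"

fun pauli :: "nat \<Rightarrow> complex ^ 2 ^ 2" where
  "pauli 0 = mat 1"
| "pauli (Suc 0) = mat2 0 1 1 0"
| "pauli (Suc (Suc 0)) = mat2 0 (- \<i>) \<i> 0"
| "pauli _ = mat2 1 0 0 (- 1)"


section \<open>Algebraic tensor products of finitely many algebras\<close>

text \<open>
  The tensor product of the algebras \<open>A x\<close>, \<open>x \<in> L\<close>, is the quotient of the free complex vector
  space on the tuples in the product of the carriers by the span of the multilinearity relations;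
  its elements are cosets. Multiplication and involution act factorwise on elementary tensors.
\<close>

type_synonym ('i, 'b) free_vec = "('i \<Rightarrow> 'b) \<Rightarrow>\<^sub>0 complex"

definition scale_vec :: "complex \<Rightarrow> ('i, 'b) free_vec \<Rightarrow> ('i, 'b) free_vec" where
  "scale_vec c = Poly_Mapping.map ((*) c)"

definition basis_vec :: "('i \<Rightarrow> 'b) \<Rightarrow> ('i, 'b) free_vec" where
  "basis_vec a = Poly_Mapping.single a 1"

definition tuples :: "('i \<Rightarrow> 'b cstar) \<Rightarrow> 'i set \<Rightarrow> ('i \<Rightarrow> 'b) set" where
  "tuples A L = (\<Pi>\<^sub>E x\<in>L. carrier (A x))"

definition multilinear_relations ::
    "('i \<Rightarrow> 'b cstar) \<Rightarrow> 'i set \<Rightarrow> ('i, 'b) free_vec set" where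
  "multilinear_relations A L =
     {basis_vec (a(x := u \<oplus>\<^bsub>A x\<^esub> v)) - basis_vec (a(x := u)) - basis_vec (a(x := v)) |a x u v.
        a \<in> tuples A L \<and> x \<in> L \<and> u \<in> carrier (A x) \<and> v \<in> carrier (A x)} \<union>
     {basis_vec (a(x := c \<odot>\<^bsub>A x\<^esub> u)) - scale_vec c (basis_vec (a(x := u))) |a x c u.
        a \<in> tuples A L \<and> x \<in> L \<and> u \<in> carrier (A x)}"

definition tensor_null :: "('i \<Rightarrow> 'b cstar) \<Rightarrow> 'i set \<Rightarrow> ('i, 'b) free_vec set" where
  "tensor_null A L = Modules.module.span scale_vec (multilinear_relations A L)"

definition tensor_class ::
    "('i \<Rightarrow> 'b cstar) \<Rightarrow> 'i set \<Rightarrow> ('i, 'b) free_vec \<Rightarrow> ('i, 'b) free_vec set" where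
  "tensor_class A L f = (\<lambda>n. f + n) ` tensor_null A L"

definition elem_tensor ::
    "('i \<Rightarrow> 'b cstar) \<Rightarrow> 'i set \<Rightarrow> ('i \<Rightarrow> 'b) \<Rightarrow> ('i, 'b) free_vec set" where
  "elem_tensor A L a = tensor_class A L (basis_vec (restrict a L))"

definition free_mult ::
    "('i \<Rightarrow> 'b cstar) \<Rightarrow> 'i set \<Rightarrow> ('i, 'b) free_vec \<Rightarrow> ('i, 'b) free_vec \<Rightarrow> ('i, 'b) free_vec" where
  "free_mult A L f g =
     (\<Sum>a\<in>Poly_Mapping.keys f. \<Sum>b\<in>Poly_Mapping.keys g.
        scale_vec (Poly_Mapping.lookup f a * Poly_Mapping.lookup g b)
          (basis_vec (\<lambda>x\<in>L. a x \<otimes>\<^bsub>A x\<^esub> b x)))"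

definition free_adj ::
    "('i \<Rightarrow> 'b cstar) \<Rightarrow> 'i set \<Rightarrow> ('i, 'b) free_vec \<Rightarrow> ('i, 'b) free_vec" where
  "free_adj A L f =
     (\<Sum>a\<in>Poly_Mapping.keys f.
        scale_vec (cnj (Poly_Mapping.lookup f a)) (basis_vec (\<lambda>x\<in>L. adj (A x) (a x))))"

text \<open>
  As for quotient rings in \<open>HOL-Algebra\<close>, operations on cosets are unions over
  representatives; all representatives give the same coset.
\<close>

definition tensor_algebra ::
    "('i \<Rightarrow> 'b cstar) \<Rightarrow> 'i set \<Rightarrow> ('i, 'b) free_vec set cstar" where
  "tensor_algebra A L = with_cstar_norm
     \<lparr>carrier = tensor_class A L ` {f. Poly_Mapping.keys f \<subseteq> tuples A L},
      mult = (\<lambda>X Y. \<Union>f\<in>X. \<Union>g\<in>Y. tensor_class A L (free_mult A L f g)),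
      one = elem_tensor A L (\<lambda>x. \<one>\<^bsub>A x\<^esub>),
      zero = tensor_class A L 0,
      add = (\<lambda>X Y. \<Union>f\<in>X. \<Union>g\<in>Y. tensor_class A L (f + g)),
      smult = (\<lambda>c X. \<Union>f\<in>X. tensor_class A L (scale_vec c f)),
      adj = (\<lambda>X. \<Union>f\<in>X. tensor_class A L (free_adj A L f)),
      cnorm = (\<lambda>_. 0)\<rparr>"

definition tensor_embed ::
    "('i \<Rightarrow> 'b cstar) \<Rightarrow> 'i set \<Rightarrow> 'i set \<Rightarrow> ('i, 'b) free_vec set \<Rightarrow> ('i, 'b) free_vec set" where
  "tensor_embed A L' L X =
     (\<Union>f\<in>X. tensor_class A L'
        (\<Sum>a\<in>Poly_Mapping.keys f.
           scale_vec (Poly_Mapping.lookup f a)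
             (basis_vec (\<lambda>x\<in>L'. if x \<in> L then a x else \<one>\<^bsub>A x\<^esub>))))"


section \<open>The spin algebra and its extension\<close>

text \<open>
  \<open>site x\<close> is the algebra at the point \<open>x\<close>, identified with the complex matrices by \<open>\<xi> x\<close>.
  \<open>\<AA>\<close> with the subalgebras \<open>loc L\<close> and the isomorphisms \<open>\<phi> L\<close> is the C*-inductive limit of the
  tensor products over the nonempty finite sets \<open>L\<close>.
\<close>

locale spin_algebra =
  fixes site :: "int \<Rightarrow> 'b cstar"
    and \<xi> :: "int \<Rightarrow> 'b \<Rightarrow> complex ^ 2 ^ 2"
    and \<AA> :: "'a cstar"
    and loc :: "int set \<Rightarrow> 'a set"
    and \<phi> :: "int set \<Rightarrow> (int, 'b) free_vec set \<Rightarrow> 'a"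
  assumes site_cstar: "cstar_algebra (site x)"
    and site_iso: "star_iso (site x) complex_mat2 (\<xi> x)"
    and cstar: "cstar_algebra \<AA>"
    and loc_subalgebra: "\<lbrakk>finite L; L \<noteq> {}\<rbrakk> \<Longrightarrow> cstar_subalgebra (loc L) \<AA> \<and> \<one>\<^bsub>\<AA>\<^esub> \<in> loc L"
    and loc_iso:
      "\<lbrakk>finite L; L \<noteq> {}\<rbrakk> \<Longrightarrow> star_iso (tensor_algebra site L) (\<AA>\<lparr>carrier := loc L\<rparr>) (\<phi> L)"
    and compatible:
      "\<lbrakk>finite L'; L \<noteq> {}; L \<subseteq> L'; X \<in> carrier (tensor_algebra site L)\<rbrakk>
       \<Longrightarrow> \<phi> L' (tensor_embed site L' L X) = \<phi> L X"
    and dense: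
      "\<lbrakk>a \<in> carrier \<AA>; e > 0\<rbrakk>
       \<Longrightarrow> \<exists>L. finite L \<and> L \<noteq> {} \<and> (\<exists>b\<in>loc L. cnorm \<AA> (a \<ominus>\<^bsub>\<AA>\<^esub> b) < e)"
begin

definition spin :: "nat \<Rightarrow> int \<Rightarrow> 'a" where
  "spin \<kappa> x =
     \<phi> {x} (elem_tensor site {x} (\<lambda>y. inv_into (carrier (site y)) (\<xi> y) (pauli \<kappa>)))"

definition spin_minus :: "int \<Rightarrow> 'a" where
  "spin_minus x = (1 / 2) \<odot>\<^bsub>\<AA>\<^esub> (spin 1 x \<ominus>\<^bsub>\<AA>\<^esub> \<i> \<odot>\<^bsub>\<AA>\<^esub> spin 2 x)"

definition string_op :: "int \<Rightarrow> 'a" where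
  "string_op x =
     foldr (\<lambda>y p. spin 3 y \<otimes>\<^bsub>\<AA>\<^esub> p) (if x \<ge> 1 then [1..x - 1] else [x..0]) \<one>\<^bsub>\<AA>\<^esub>"

end

text \<open>The *-automorphism \<open>\<Theta>\<close> is determined by its values on the spins.\<close>

locale spin_extension = spin_algebra site \<xi> \<AA> loc \<phi>
  for site :: "int \<Rightarrow> 'b cstar"
    and \<xi> :: "int \<Rightarrow> 'b \<Rightarrow> complex ^ 2 ^ 2"
    and \<AA> :: "'a cstar"
    and loc :: "int set \<Rightarrow> 'a set"
    and \<phi> :: "int set \<Rightarrow> (int, 'b) free_vec set \<Rightarrow> 'a" +
  fixes \<Theta> :: "'a \<Rightarrow> 'a"
  assumes \<Theta>_iso: "star_iso \<AA> \<AA> \<Theta>"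
    and \<Theta>_right: "\<lbrakk>\<kappa> \<le> 3; x \<ge> 1\<rbrakk> \<Longrightarrow> \<Theta> (spin \<kappa> x) = spin \<kappa> x"
    and \<Theta>_left:
      "\<lbrakk>\<kappa> \<le> 3; x \<le> 0\<rbrakk>
       \<Longrightarrow> \<Theta> (spin \<kappa> x) = (if \<kappa> \<in> {0, 3} then 1 else - 1) \<odot>\<^bsub>\<AA>\<^esub> spin \<kappa> x"
begin

definition hat_algebra :: "('a ^ 2 ^ 2) cstar" where
  "hat_algebra =
     mat2_over \<AA>\<lparr>carrier := {mat2 a b (\<Theta> b) (\<Theta> a) |a b. a \<in> carrier \<AA> \<and> b \<in> carrier \<AA>}\<rparr>"

definition \<psi> :: "'a \<Rightarrow> 'a ^ 2 ^ 2" where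
  "\<psi> a = mat2 a \<zero>\<^bsub>\<AA>\<^esub> \<zero>\<^bsub>\<AA>\<^esub> (\<Theta> a)"

definition T :: "'a ^ 2 ^ 2" where
  "T = mat2 \<zero>\<^bsub>\<AA>\<^esub> \<one>\<^bsub>\<AA>\<^esub> \<one>\<^bsub>\<AA>\<^esub> \<zero>\<^bsub>\<AA>\<^esub>"

definition annih :: "int \<Rightarrow> 'a ^ 2 ^ 2" where
  "annih x = T \<otimes>\<^bsub>hat_algebra\<^esub> \<psi> (string_op x \<otimes>\<^bsub>\<AA>\<^esub> spin_minus x)"

definition hat_algebra1 :: "('a ^ 2 ^ 2) cstar" where
  "hat_algebra1 = hat_algebra\<lparr>carrier := cstar_generated hat_algebra (range annih)\<rparr>"

end

end

theory Submission
  imports Defs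
begin

text \<open>
  Spins at distinct sites commute, whereas the operators \<open>a_x\<close> anticommute. Hence a homomorphism
  with \<open>\<sigma>_-^(x) \<mapsto> a_x\<close> and \<open>\<sigma>_-^(y) \<mapsto> a_y\<close> would force \<open>a_x a_y = 0\<close>. But the upper left
  entry of \<open>a_x a_y\<close> is, up to sign, \<open>S_x S_y \<sigma>_-^(x) \<sigma>_-^(y)\<close>. It does not vanish, because
  \<open>S_x^2 = S_y^2 = 1\<close>, because \<open>\<sigma>_+ \<sigma>_- + \<sigma>_- \<sigma>_+ = 1\<close> at each site allows both lowering operators
  to be cancelled, and because \<open>1 \<noteq> 0\<close> in the inductive limit. The last point comes from the
  injectivity of the local isomorphisms and a linear functional on a one-site tensor product.
\<close>

section \<open>Multiplication in the algebraic tensor product\<close>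

lemma lookup_scale_vec [simp]: "Poly_Mapping.lookup (scale_vec c f) a = c * Poly_Mapping.lookup f a"
  by (simp add: scale_vec_def Poly_Mapping.map.rep_eq when_def)

lemma lookup_basis_vec: "Poly_Mapping.lookup (basis_vec a) b = (if a = b then 1 else 0)"
  by (simp add: basis_vec_def lookup_single when_def)

lemma keys_basis_vec [simp]: "Poly_Mapping.keys (basis_vec a) = {a}"
  by (simp add: basis_vec_def)

interpretation free_vec: vector_space scale_vec
  by unfold_locales (auto intro!: poly_mapping_eqI simp: lookup_add algebra_simps)

text \<open>The sums over \<open>keys\<close> in \<open>free_mult\<close> and
  \<open>tensor_embed\<close> are instances of this extension, so their linearity has to be proved
  only once.\<close>

definition lin_ext ::
    "(('i \<Rightarrow> 'b) \<Rightarrow> ('j, 'c) free_vec) \<Rightarrow> ('i, 'b) free_vec \<Rightarrow> ('j, 'c) free_vec" where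
  "lin_ext g f = (\<Sum>a\<in>Poly_Mapping.keys f. scale_vec (Poly_Mapping.lookup f a) (g a))"

text \<open>Vectors outside the support have coefficient 0. Sums belonging to different vectors can
  thus be taken over a common finite set before they are compared.\<close>

lemma lin_ext_superset:
  assumes "finite S" "Poly_Mapping.keys f \<subseteq> S"
  shows "lin_ext g f = (\<Sum>a\<in>S. scale_vec (Poly_Mapping.lookup f a) (g a))"
  unfolding lin_ext_def using assms
  by (intro sum.mono_neutral_left) (auto simp: in_keys_iff)

lemma lin_ext_add: "lin_ext g (f + f') = lin_ext g f + lin_ext g f'"
proof -
  let ?S = "Poly_Mapping.keys f \<union> Poly_Mapping.keys f'"
  have "lin_ext g h = (\<Sum>a\<in>?S. scale_vec (Poly_Mapping.lookup h a) (g a))"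
    if "h \<in> {f, f', f + f'}" for h
    using that keys_add[of f f'] by (intro lin_ext_superset) auto
  then show ?thesis
    by (simp add: lookup_add free_vec.scale_left_distrib sum.distrib)
qed

lemma lin_ext_scale: "lin_ext g (scale_vec c f) = scale_vec c (lin_ext g f)"
proof -
  have "Poly_Mapping.keys (scale_vec c f) \<subseteq> Poly_Mapping.keys f"
    by (auto simp: in_keys_iff)
  then have "lin_ext g (scale_vec c f) =
      (\<Sum>a\<in>Poly_Mapping.keys f. scale_vec (Poly_Mapping.lookup (scale_vec c f) a) (g a))"
    by (intro lin_ext_superset) auto
  then show ?thesis
    by (simp add: lin_ext_def free_vec.scale_sum_right)
qed

lemma lin_ext_basis [simp]: "lin_ext g (basis_vec a) = g a"
  by (simp add: lin_ext_def lookup_basis_vec)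

lemma lin_ext_0 [simp]: "lin_ext g 0 = 0"
  by (simp add: lin_ext_def)

lemma lin_ext_diff: "lin_ext g (f - f') = lin_ext g f - lin_ext g f'"
  using lin_ext_add[of g "f - f'" f'] by simp

lemma lin_ext_basis_vec: "lin_ext basis_vec f = f"
proof (rule poly_mapping_eqI)
  fix b
  have "Poly_Mapping.lookup (lin_ext basis_vec f) b =
      (\<Sum>a\<in>Poly_Mapping.keys f. Poly_Mapping.lookup f a * (if a = b then 1 else 0))"
    by (simp add: lin_ext_def lookup_sum lookup_basis_vec)
  also have "\<dots> = Poly_Mapping.lookup f b"
    by (simp add: in_keys_iff if_distrib cong: if_cong)
  finally show "Poly_Mapping.lookup (lin_ext basis_vec f) b = Poly_Mapping.lookup f b" .
qed

lemma lin_ext_add_fun: "lin_ext (\<lambda>a. g a + h a) f = lin_ext g f + lin_ext h f"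
  by (simp add: lin_ext_def free_vec.scale_right_distrib sum.distrib)

lemma lin_ext_in_subspace:
  assumes "free_vec.subspace N" "\<And>a. a \<in> Poly_Mapping.keys f \<Longrightarrow> g a \<in> N"
  shows "lin_ext g f \<in> N"
  unfolding lin_ext_def using assms
  by (intro free_vec.subspace_sum free_vec.subspace_scale) auto

text \<open>With \<open>N\<close> a null space this shows that a linear map descends to cosets; with
  \<open>N = {0}\<close> it shows that the map vanishes on the whole null space once it kills the
  generators.\<close>

lemma lin_ext_span:
  assumes "f \<in> free_vec.span R" "free_vec.subspace N" "\<And>r. r \<in> R \<Longrightarrow> lin_ext g r \<in> N"
  shows "lin_ext g f \<in> N"
  using assms(1)
proof (induction rule: free_vec.span_induct_alt)
  case base
  then show ?case using assms(2) by (simp add: free_vec.subspace_0)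
next
  case (step c x y)
  then show ?case using assms(2,3)
    by (simp add: lin_ext_add lin_ext_scale free_vec.subspace_add free_vec.subspace_scale)
qed

lemma subspace_keys:
  fixes S :: "('i \<Rightarrow> 'b) set"
  shows "free_vec.subspace {f. Poly_Mapping.keys f \<subseteq> S}"
proof (rule free_vec.subspaceI)
  fix f g :: "('i, 'b) free_vec"
  assume "f \<in> {f. Poly_Mapping.keys f \<subseteq> S}" "g \<in> {f. Poly_Mapping.keys f \<subseteq> S}"
  then show "f + g \<in> {f. Poly_Mapping.keys f \<subseteq> S}"
    using keys_add[of f g] by blast
next
  fix c and f :: "('i, 'b) free_vec"
  assume "f \<in> {f. Poly_Mapping.keys f \<subseteq> S}"
  moreover have "Poly_Mapping.keys (scale_vec c f) \<subseteq> Poly_Mapping.keys f"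
    by (auto simp: in_keys_iff)
  ultimately show "scale_vec c f \<in> {f. Poly_Mapping.keys f \<subseteq> S}"
    by blast
qed simp

definition tuple_mult :: "('i \<Rightarrow> 'b cstar) \<Rightarrow> 'i set \<Rightarrow> ('i \<Rightarrow> 'b) \<Rightarrow> ('i \<Rightarrow> 'b) \<Rightarrow> 'i \<Rightarrow> 'b" where
  "tuple_mult A L a b = (\<lambda>x\<in>L. a x \<otimes>\<^bsub>A x\<^esub> b x)"

lemma free_mult_lin_ext:
  "free_mult A L f g = lin_ext (\<lambda>a. lin_ext (\<lambda>b. basis_vec (tuple_mult A L a b)) g) f"
  by (simp add: free_mult_def lin_ext_def tuple_mult_def free_vec.scale_sum_right)

text \<open>Interchanging the two finite sums puts the left factor into the inner extension, where
  it can be studied for one fixed right tuple at a time.\<close>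

lemma free_mult_swap:
  "free_mult A L f g = lin_ext (\<lambda>b. lin_ext (\<lambda>a. basis_vec (tuple_mult A L a b)) f) g"
  unfolding free_mult_lin_ext lin_ext_def free_vec.scale_sum_right free_vec.scale_scale
  by (subst sum.swap) (simp only: mult.commute)

lemma free_mult_add_left: "free_mult A L (f + f') g = free_mult A L f g + free_mult A L f' g"
  and free_mult_add_right: "free_mult A L h (g + g') = free_mult A L h g + free_mult A L h g'"
  by (simp_all add: free_mult_lin_ext lin_ext_add lin_ext_add_fun)

section \<open>Cosets of the null space\<close>

lemma subspace_tensor_null: "free_vec.subspace (tensor_null A L)"
  by (simp add: tensor_null_def)

lemma in_tensor_class_iff: "g \<in> tensor_class A L f \<longleftrightarrow> g - f \<in> tensor_null A L"
  by (force simp: tensor_class_def)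

lemma tensor_class_eq_iff:
  "tensor_class A L f = tensor_class A L g \<longleftrightarrow> f - g \<in> tensor_null A L"
proof
  assume "tensor_class A L f = tensor_class A L g"
  moreover have "f \<in> tensor_class A L f"
    using free_vec.subspace_0[OF subspace_tensor_null] by (simp add: in_tensor_class_iff)
  ultimately show "f - g \<in> tensor_null A L"
    by (simp add: in_tensor_class_iff)
next
  assume *: "f - g \<in> tensor_null A L"
  have "h - f \<in> tensor_null A L \<longleftrightarrow> h - g \<in> tensor_null A L" for h
    using free_vec.subspace_add[OF subspace_tensor_null _ *, of "h - f"]
      free_vec.subspace_diff[OF subspace_tensor_null _ *, of "h - g"] by auto
  then show "tensor_class A L f = tensor_class A L g"
    by (auto simp: in_tensor_class_iff)
qed

text \<open>Under the assumption all representatives give the same coset, and \<open>f\<close> is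
  one of them, so the union collapses. This turns well-definedness of a coset operation into a rule
  for evaluating it.\<close>

lemma UN_tensor_class:
  assumes "\<And>f'. f' - f \<in> tensor_null A L \<Longrightarrow> h f' - h f \<in> tensor_null B K"
  shows "(\<Union>f'\<in>tensor_class A L f. tensor_class B K (h f')) = tensor_class B K (h f)"
proof -
  have "tensor_class B K (h f') = tensor_class B K (h f)" if "f' \<in> tensor_class A L f" for f'
    using that assms by (simp add: in_tensor_class_iff tensor_class_eq_iff)
  moreover have "f \<in> tensor_class A L f"
    using free_vec.subspace_0[OF subspace_tensor_null] by (simp add: in_tensor_class_iff)
  ultimately show ?thesis by blast
qed

lemma UN2_tensor_class:
  assumes "\<And>f' g'. f' - f \<in> tensor_null A L \<Longrightarrow> g' - g \<in> tensor_null A L \<Longrightarrow>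
             h f' g' - h f g \<in> tensor_null A L"
  shows "(\<Union>f'\<in>tensor_class A L f. \<Union>g'\<in>tensor_class A L g. tensor_class A L (h f' g')) =
         tensor_class A L (h f g)"
proof -
  have "tensor_class A L (h f' g') = tensor_class A L (h f g)"
    if "f' \<in> tensor_class A L f" "g' \<in> tensor_class A L g" for f' g'
    using that assms by (simp add: in_tensor_class_iff tensor_class_eq_iff)
  moreover have "f \<in> tensor_class A L f" for f
    using free_vec.subspace_0[OF subspace_tensor_null] by (simp add: in_tensor_class_iff)
  ultimately show ?thesis by blast
qed

text \<open>\<open>with_cstar_norm\<close> alters only the field \<open>cnorm\<close>, so the
  algebraic operations can be read off without knowing that a C*-norm exists.\<close>

lemma tensor_algebra_sel [simp]:
  "carrier (tensor_algebra A L) = tensor_class A L ` {f. Poly_Mapping.keys f \<subseteq> tuples A L}"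
  "mult (tensor_algebra A L) = (\<lambda>X Y. \<Union>f\<in>X. \<Union>g\<in>Y. tensor_class A L (free_mult A L f g))"
  "one (tensor_algebra A L) = elem_tensor A L (\<lambda>x. \<one>\<^bsub>A x\<^esub>)"
  "add (tensor_algebra A L) = (\<lambda>X Y. \<Union>f\<in>X. \<Union>g\<in>Y. tensor_class A L (f + g))"
  "smult (tensor_algebra A L) = (\<lambda>c X. \<Union>f\<in>X. tensor_class A L (scale_vec c f))"
  by (simp_all add: tensor_algebra_def with_cstar_norm_def)

lemma tensor_add_class:
  "tensor_class A L f \<oplus>\<^bsub>tensor_algebra A L\<^esub> tensor_class A L g = tensor_class A L (f + g)"
proof -
  have "(f' + g') - (f + g) \<in> tensor_null A L"
    if "f' - f \<in> tensor_null A L" "g' - g \<in> tensor_null A L" for f' g'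
    using free_vec.subspace_add[OF subspace_tensor_null that] by (simp add: algebra_simps)
  then show ?thesis
    unfolding tensor_algebra_sel by (rule UN2_tensor_class)
qed

lemma tensor_smult_class:
  "c \<odot>\<^bsub>tensor_algebra A L\<^esub> tensor_class A L f = tensor_class A L (scale_vec c f)"
proof -
  have "scale_vec c f' - scale_vec c f \<in> tensor_null A L"
    if "f' - f \<in> tensor_null A L" for f'
    using free_vec.subspace_scale[OF subspace_tensor_null that]
    by (simp add: free_vec.scale_right_diff_distrib)
  then show ?thesis
    unfolding tensor_algebra_sel by (rule UN_tensor_class)
qed

section \<open>Multilinearity of elementary tensors\<close>

lemma relation_addI:
  assumes "a \<in> tuples A L" "x \<in> L" "u \<in> carrier (A x)" "v \<in> carrier (A x)"
  shows "basis_vec (a(x := u \<oplus>\<^bsub>A x\<^esub> v)) - basis_vec (a(x := u)) - basis_vec (a(x := v))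
    \<in> multilinear_relations A L"
  unfolding multilinear_relations_def using assms by blast

lemma relation_smultI:
  assumes "a \<in> tuples A L" "x \<in> L" "u \<in> carrier (A x)"
  shows "basis_vec (a(x := c \<odot>\<^bsub>A x\<^esub> u)) - scale_vec c (basis_vec (a(x := u)))
    \<in> multilinear_relations A L"
  unfolding multilinear_relations_def using assms by blast

lemma multilinear_relations_cases:
  assumes "r \<in> multilinear_relations A L"
  obtains (add) a x u v where "r = basis_vec (a(x := u \<oplus>\<^bsub>A x\<^esub> v)) - basis_vec (a(x := u)) - basis_vec (a(x := v))"
      "a \<in> tuples A L" "x \<in> L" "u \<in> carrier (A x)" "v \<in> carrier (A x)"
  | (smult) a x c u where "r = basis_vec (a(x := c \<odot>\<^bsub>A x\<^esub> u)) - scale_vec c (basis_vec (a(x := u)))"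
      "a \<in> tuples A L" "x \<in> L" "u \<in> carrier (A x)"
  using assms unfolding multilinear_relations_def by blast

lemma elem_tensor_carrier:
  assumes "\<And>x. x \<in> L \<Longrightarrow> a x \<in> carrier (A x)"
  shows "elem_tensor A L a \<in> carrier (tensor_algebra A L)"
  using assms by (auto simp: elem_tensor_def tuples_def intro!: imageI)

lemma elem_tensor_add:
  assumes "x \<in> L" "\<And>y. y \<in> L \<Longrightarrow> a y \<in> carrier (A y)" "u \<in> carrier (A x)" "v \<in> carrier (A x)"
  shows "elem_tensor A L (a(x := u \<oplus>\<^bsub>A x\<^esub> v)) =
    elem_tensor A L (a(x := u)) \<oplus>\<^bsub>tensor_algebra A L\<^esub> elem_tensor A L (a(x := v))"
proof -
  have "basis_vec ((restrict a L)(x := u \<oplus>\<^bsub>A x\<^esub> v)) - basis_vec ((restrict a L)(x := u))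
      - basis_vec ((restrict a L)(x := v)) \<in> multilinear_relations A L"
    using assms by (intro relation_addI) (auto simp: tuples_def)
  moreover have "restrict (a(x := w)) L = (restrict a L)(x := w)" for w
    using assms(1) by auto
  ultimately show ?thesis
    by (simp add: elem_tensor_def tensor_add_class tensor_class_eq_iff tensor_null_def
        free_vec.span_base diff_diff_add del: tensor_algebra_sel)
qed

lemma elem_tensor_smult:
  assumes "x \<in> L" "\<And>y. y \<in> L \<Longrightarrow> a y \<in> carrier (A y)" "u \<in> carrier (A x)"
  shows "elem_tensor A L (a(x := c \<odot>\<^bsub>A x\<^esub> u)) =
    c \<odot>\<^bsub>tensor_algebra A L\<^esub> elem_tensor A L (a(x := u))"
proof -
  have "basis_vec ((restrict a L)(x := c \<odot>\<^bsub>A x\<^esub> u)) - scale_vec c (basis_vec ((restrict a L)(x := u)))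
      \<in> multilinear_relations A L"
    using assms by (intro relation_smultI) (auto simp: tuples_def)
  moreover have "restrict (a(x := w)) L = (restrict a L)(x := w)" for w
    using assms(1) by auto
  ultimately show ?thesis
    by (simp add: elem_tensor_def tensor_smult_class tensor_class_eq_iff tensor_null_def
        free_vec.span_base del: tensor_algebra_sel)
qed

lemma tuple_upd: "a \<in> tuples A L \<Longrightarrow> x \<in> L \<Longrightarrow> u \<in> carrier (A x) \<Longrightarrow> a(x := u) \<in> tuples A L"
  using PiE_fun_upd[of u "\<lambda>x. carrier (A x)" x a L] by (simp add: tuples_def insert_absorb)

section \<open>The null space as a two-sided ideal\<close>

context
  fixes A :: "'i \<Rightarrow> 'b cstar" and L :: "'i set"
  assumes factors: "\<And>x. x \<in> L \<Longrightarrow> cstar_algebra (A x)"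
begin

lemma factor_ring: "x \<in> L \<Longrightarrow> ring (A x)"
  and factor_module: "x \<in> L \<Longrightarrow> Module.module complex_ring (A x)"
  by (simp_all add: factors[THEN cstar_algebra.axioms(1)] factors[THEN cstar_algebra.axioms(2)])

text \<open>Each relation combines basis vectors of updated tuples, and these are again admissible
  because every factor is closed under addition and scaling.\<close>

lemma multilinear_relations_subspace:
  assumes N: "free_vec.subspace N" "basis_vec ` tuples A L \<subseteq> N"
    and r: "r \<in> multilinear_relations A L"
  shows "r \<in> N"
proof -
  have upd: "basis_vec (a(x := w)) \<in> N" if "a \<in> tuples A L" "x \<in> L" "w \<in> carrier (A x)" for a x w
    using N(2) tuple_upd[of a A L x w] that by blast
  show ?thesis
    using r
  proof (cases rule: multilinear_relations_cases)
    case (add a x u v)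
    interpret ring "A x" using factor_ring add(3) .
    show ?thesis
      unfolding add(1) using add(2-) by (intro free_vec.subspace_diff N(1) upd) auto
  next
    case (smult a x c u)
    interpret Module.module complex_ring "A x" using factor_module smult(3) .
    have "c \<odot>\<^bsub>A x\<^esub> u \<in> carrier (A x)"
      using smult(4) by (simp add: complex_ring_def)
    then show ?thesis
      unfolding smult(1) using smult(2-)
      by (intro free_vec.subspace_diff free_vec.subspace_scale N(1) upd) auto
  qed
qed

lemma tensor_null_subspace:
  assumes "free_vec.subspace N" "basis_vec ` tuples A L \<subseteq> N"
  shows "tensor_null A L \<subseteq> N"
  unfolding tensor_null_def using multilinear_relations_subspace assms
  by (intro free_vec.span_minimal) auto

lemma tuple_mult_closed:
  assumes "a \<in> tuples A L" "b \<in> tuples A L"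
  shows "tuple_mult A L a b \<in> tuples A L"
proof -
  have "a x \<otimes>\<^bsub>A x\<^esub> b x \<in> carrier (A x)" if "x \<in> L" for x
  proof -
    interpret ring "A x" using factor_ring that .
    show ?thesis using assms that by (auto simp: tuples_def)
  qed
  then show ?thesis by (simp add: tuples_def tuple_mult_def)
qed

text \<open>Multiplying by a fixed tuple \<open>b\<close> acts on the updated slot as right
  multiplication by \<open>b x\<close>. Distributivity and compatibility with scalars in that factor
  therefore turn a relation into another relation of the same kind.\<close>

lemma relation_mult_left:
  assumes "r \<in> multilinear_relations A L" "b \<in> tuples A L"
  shows "lin_ext (\<lambda>a. basis_vec (tuple_mult A L a b)) r \<in> multilinear_relations A L"
  using assms(1)
proof (cases rule: multilinear_relations_cases)
  case (add a x u v)
  interpret ring "A x" using factor_ring add(3) .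
  have upd: "tuple_mult A L (a(x := w)) b = (tuple_mult A L a b)(x := w \<otimes>\<^bsub>A x\<^esub> b x)" for w
    using add(3) by (auto simp: tuple_mult_def fun_eq_iff)
  have b: "b x \<in> carrier (A x)"
    using assms(2) add(3) by (auto simp: tuples_def)
  have T: "tuple_mult A L a b \<in> tuples A L"
    using tuple_mult_closed add(2) assms(2) by blast
  show ?thesis
    unfolding add(1) lin_ext_diff lin_ext_basis upd l_distr[OF add(4,5) b]
    by (intro relation_addI T m_closed add b)
next
  case (smult a x c u)
  interpret cstar_algebra "A x" using factors smult(3) .
  have upd: "tuple_mult A L (a(x := w)) b = (tuple_mult A L a b)(x := w \<otimes>\<^bsub>A x\<^esub> b x)" for w
    using smult(3) by (auto simp: tuple_mult_def fun_eq_iff)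
  have b: "b x \<in> carrier (A x)"
    using assms(2) smult(3) by (auto simp: tuples_def)
  have T: "tuple_mult A L a b \<in> tuples A L"
    using tuple_mult_closed smult(2) assms(2) by blast
  show ?thesis
    unfolding smult(1) lin_ext_diff lin_ext_scale lin_ext_basis upd smult_mult_left[OF smult(4) b]
    by (intro relation_smultI T smult b
        monoid.m_closed[OF ring.is_monoid[OF factor_ring[OF smult(3)]]])
qed

lemma relation_mult_right:
  assumes "r \<in> multilinear_relations A L" "b \<in> tuples A L"
  shows "lin_ext (\<lambda>a. basis_vec (tuple_mult A L b a)) r \<in> multilinear_relations A L"
  using assms(1)
proof (cases rule: multilinear_relations_cases)
  case (add a x u v)
  interpret ring "A x" using factor_ring add(3) .
  have upd: "tuple_mult A L b (a(x := w)) = (tuple_mult A L b a)(x := b x \<otimes>\<^bsub>A x\<^esub> w)" for w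
    using add(3) by (auto simp: tuple_mult_def fun_eq_iff)
  have b: "b x \<in> carrier (A x)"
    using assms(2) add(3) by (auto simp: tuples_def)
  have T: "tuple_mult A L b a \<in> tuples A L"
    using tuple_mult_closed add(2) assms(2) by blast
  show ?thesis
    unfolding add(1) lin_ext_diff lin_ext_basis upd r_distr[OF add(4,5) b]
    by (intro relation_addI T m_closed add b)
next
  case (smult a x c u)
  interpret cstar_algebra "A x" using factors smult(3) .
  have upd: "tuple_mult A L b (a(x := w)) = (tuple_mult A L b a)(x := b x \<otimes>\<^bsub>A x\<^esub> w)" for w
    using smult(3) by (auto simp: tuple_mult_def fun_eq_iff)
  have b: "b x \<in> carrier (A x)"
    using assms(2) smult(3) by (auto simp: tuples_def)
  have T: "tuple_mult A L b a \<in> tuples A L"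
    using tuple_mult_closed smult(2) assms(2) by blast
  show ?thesis
    unfolding smult(1) lin_ext_diff lin_ext_scale lin_ext_basis upd smult_mult_right[OF b smult(4)]
    by (intro relation_smultI T smult b
        monoid.m_closed[OF ring.is_monoid[OF factor_ring[OF smult(3)]]])
qed

text \<open>For each tuple of \<open>g\<close> the generators of the null space go to generators;
  the product with \<open>g\<close> is a linear combination of such images.\<close>

lemma free_mult_null_left:
  assumes "n \<in> tensor_null A L" "Poly_Mapping.keys g \<subseteq> tuples A L"
  shows "free_mult A L n g \<in> tensor_null A L"
  unfolding free_mult_swap
proof (rule lin_ext_in_subspace[OF subspace_tensor_null])
  fix b assume "b \<in> Poly_Mapping.keys g"
  then have b: "b \<in> tuples A L" using assms(2) by blast
  show "lin_ext (\<lambda>a. basis_vec (tuple_mult A L a b)) n \<in> tensor_null A L"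
    using assms(1) unfolding tensor_null_def
    by (rule lin_ext_span) (intro free_vec.subspace_span free_vec.span_base relation_mult_left b)+
qed

lemma free_mult_null_right:
  assumes "n \<in> tensor_null A L" "Poly_Mapping.keys g \<subseteq> tuples A L"
  shows "free_mult A L g n \<in> tensor_null A L"
  unfolding free_mult_lin_ext
proof (rule lin_ext_in_subspace[OF subspace_tensor_null])
  fix b assume "b \<in> Poly_Mapping.keys g"
  then have b: "b \<in> tuples A L" using assms(2) by blast
  show "lin_ext (\<lambda>a. basis_vec (tuple_mult A L b a)) n \<in> tensor_null A L"
    using assms(1) unfolding tensor_null_def
    by (rule lin_ext_span) (intro free_vec.subspace_span free_vec.span_base relation_mult_right b)+
qed

text \<open>Ensures that changing the representative of a coset keeps its support inside the
  admissible tuples, as the ideal property requires.\<close>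

lemma keys_tensor_null:
  assumes "n \<in> tensor_null A L"
  shows "Poly_Mapping.keys n \<subseteq> tuples A L"
proof -
  have "tensor_null A L \<subseteq> {f. Poly_Mapping.keys f \<subseteq> tuples A L}"
    by (rule tensor_null_subspace[OF subspace_keys]) (simp add: image_subset_iff)
  then show ?thesis using assms by blast
qed

lemma tensor_mult_class:
  assumes "Poly_Mapping.keys f \<subseteq> tuples A L" "Poly_Mapping.keys g \<subseteq> tuples A L"
  shows "tensor_class A L f \<otimes>\<^bsub>tensor_algebra A L\<^esub> tensor_class A L g =
    tensor_class A L (free_mult A L f g)"
proof -
  have "free_mult A L f' g' - free_mult A L f g \<in> tensor_null A L"
    if "f' - f \<in> tensor_null A L" "g' - g \<in> tensor_null A L" for f' g'
  proof -
    \<comment> \<open>The sum is \<open>g'\<close>, written so that its support is bounded by those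
      of \<open>g\<close> and of a null vector.\<close>
    have "Poly_Mapping.keys (g + (g' - g)) \<subseteq> tuples A L"
      using assms(2) keys_tensor_null[OF that(2)] keys_add[of g "g' - g"] by blast
    then have "free_mult A L (f' - f) g' \<in> tensor_null A L"
      using free_mult_null_left that(1) by simp
    moreover have "free_mult A L f (g' - g) \<in> tensor_null A L"
      using free_mult_null_right that(2) assms(1) .
    \<comment> \<open>The two factors are replaced one after the other, so each summand contains
      exactly one null factor.\<close>
    moreover have "free_mult A L f' g' - free_mult A L f g =
        free_mult A L (f' - f) g' + free_mult A L f (g' - g)"
      using free_mult_add_left[of A L "f' - f" f g'] free_mult_add_right[of A L f "g' - g" g]
      by simp
    ultimately show ?thesis
      by (simp only: free_vec.subspace_add[OF subspace_tensor_null])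
  qed
  then show ?thesis
    unfolding tensor_algebra_sel by (rule UN2_tensor_class)
qed

lemma elem_tensor_mult:
  assumes "\<And>x. x \<in> L \<Longrightarrow> a x \<in> carrier (A x)" "\<And>x. x \<in> L \<Longrightarrow> b x \<in> carrier (A x)"
  shows "elem_tensor A L a \<otimes>\<^bsub>tensor_algebra A L\<^esub> elem_tensor A L b =
    elem_tensor A L (\<lambda>x. a x \<otimes>\<^bsub>A x\<^esub> b x)"
proof -
  have "restrict a L \<in> tuples A L" "restrict b L \<in> tuples A L"
    using assms by (auto simp: tuples_def)
  moreover have "tuple_mult A L (restrict a L) (restrict b L) = (\<lambda>x\<in>L. a x \<otimes>\<^bsub>A x\<^esub> b x)"
    by (auto simp: tuple_mult_def)
  ultimately show ?thesis
    by (simp add: elem_tensor_def tensor_mult_class free_mult_lin_ext del: tensor_algebra_sel)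
qed

text \<open>Prepares \<open>phi_one\<close>: the local isomorphisms are not assumed to be unital, so
  the unit law has to be available inside the tensor product.\<close>

lemma tensor_l_one:
  assumes "X \<in> carrier (tensor_algebra A L)"
  shows "\<one>\<^bsub>tensor_algebra A L\<^esub> \<otimes>\<^bsub>tensor_algebra A L\<^esub> X = X"
proof -
  obtain f where X: "X = tensor_class A L f" and f: "Poly_Mapping.keys f \<subseteq> tuples A L"
    using assms by auto
  let ?e = "\<lambda>x\<in>L. \<one>\<^bsub>A x\<^esub>"
  have one: "\<one>\<^bsub>A x\<^esub> \<in> carrier (A x)" "b \<in> carrier (A x) \<Longrightarrow> \<one>\<^bsub>A x\<^esub> \<otimes>\<^bsub>A x\<^esub> b = b" if "x \<in> L" for x b
    using factor_ring[OF that] by (simp_all add: ring.ring_simprules)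
  then have e: "?e \<in> tuples A L" by (auto simp: tuples_def)
  \<comment> \<open>Admissible tuples and restricted products are both \<open>undefined\<close>
    outside \<open>L\<close>, so the two sides agree as functions on the whole index type.\<close>
  have "tuple_mult A L ?e b = b" if "b \<in> tuples A L" for b
    using that one by (auto simp: tuple_mult_def tuples_def PiE_iff extensional_def)
  then have "free_mult A L (basis_vec ?e) f = lin_ext basis_vec f"
    unfolding free_mult_lin_ext lin_ext_basis using f unfolding lin_ext_def
    by (intro sum.cong) auto
  then show ?thesis
    using e f by (simp add: X elem_tensor_def tensor_mult_class lin_ext_basis_vec
        del: tensor_algebra_sel(1,2))
qed

end

text \<open>Filling the new slots with units commutes with updating a slot in \<open>L\<close>.
  Relations over \<open>L\<close> thus become relations over \<open>L'\<close>, and the value on a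
  coset can be computed from any representative.\<close>

lemma tensor_embed_elem:
  assumes "\<And>x. x \<in> L' \<Longrightarrow> cstar_algebra (A x)" "L \<subseteq> L'"
  shows "tensor_embed A L' L (elem_tensor A L a) =
    elem_tensor A L' (\<lambda>x. if x \<in> L then a x else \<one>\<^bsub>A x\<^esub>)"
proof -
  define E where "E a = (\<lambda>x\<in>L'. if x \<in> L then a x else \<one>\<^bsub>A x\<^esub>)" for a
  have tup: "E a \<in> tuples A L'" if "a \<in> tuples A L" for a
    using that assms(1)[THEN cstar_algebra.axioms(1)]
    by (auto simp: E_def tuples_def PiE_iff ring.ring_simprules)
  have upd: "E (a(x := w)) = (E a)(x := w)" if "x \<in> L" for a x w
    using that assms(2) by (auto simp: E_def fun_eq_iff)
  have rel: "lin_ext (\<lambda>a. basis_vec (E a)) r \<in> multilinear_relations A L'"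
    if "r \<in> multilinear_relations A L" for r
    using that
  proof (cases rule: multilinear_relations_cases)
    case (add a x u v)
    then show ?thesis
      unfolding add(1) lin_ext_diff lin_ext_basis upd[OF add(3)]
      using assms(2) by (intro relation_addI tup) auto
  next
    case (smult a x c u)
    then show ?thesis
      unfolding smult(1) lin_ext_diff lin_ext_scale lin_ext_basis upd[OF smult(3)]
      using assms(2) by (intro relation_smultI tup) auto
  qed
  have null: "lin_ext (\<lambda>a. basis_vec (E a)) n \<in> tensor_null A L'" if "n \<in> tensor_null A L" for n
    using that unfolding tensor_null_def
    by (rule lin_ext_span) (intro free_vec.subspace_span free_vec.span_base rel)+
  have "tensor_embed A L' L (elem_tensor A L a) =
      (\<Union>f\<in>tensor_class A L (basis_vec (restrict a L)). tensor_class A L' (lin_ext (\<lambda>a. basis_vec (E a)) f))"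
    by (simp add: tensor_embed_def elem_tensor_def lin_ext_def E_def)
  also have "\<dots> = tensor_class A L' (lin_ext (\<lambda>a. basis_vec (E a)) (basis_vec (restrict a L)))"
    by (rule UN_tensor_class) (simp only: null flip: lin_ext_diff)
  also have "E (restrict a L) = restrict (\<lambda>x. if x \<in> L then a x else \<one>\<^bsub>A x\<^esub>) L'"
    by (auto simp: E_def)
  then have "tensor_class A L' (lin_ext (\<lambda>a. basis_vec (E a)) (basis_vec (restrict a L))) =
      elem_tensor A L' (\<lambda>x. if x \<in> L then a x else \<one>\<^bsub>A x\<^esub>)"
    by (simp add: elem_tensor_def)
  finally show ?thesis .
qed

text \<open>The functional \<open>h\<close> on the single factor extends linearly to the free space
  and kills the relations, hence the null space; it does not kill the basis vector of
  \<open>a\<close>.\<close>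

lemma elem_tensor_singleton_neq_0:
  fixes h :: "'b \<Rightarrow> complex"
  assumes "\<And>u v. u \<in> carrier (A x) \<Longrightarrow> v \<in> carrier (A x) \<Longrightarrow> h (u \<oplus>\<^bsub>A x\<^esub> v) = h u + h v"
    and "\<And>c u. u \<in> carrier (A x) \<Longrightarrow> h (c \<odot>\<^bsub>A x\<^esub> u) = c * h u"
    and "h (a x) \<noteq> 0"
  shows "elem_tensor A {x} a \<noteq> tensor_class A {x} 0"
proof
  assume "elem_tensor A {x} a = tensor_class A {x} 0"
  then have "basis_vec (restrict a {x}) \<in> tensor_null A {x}"
    by (simp add: elem_tensor_def tensor_class_eq_iff)
  \<comment> \<open>The values of \<open>lin_ext\<close> lie in a free vector space, so the scalars
    are modelled by the free space on the single function from \<open>unit\<close> to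
    \<open>unit\<close>.\<close>
  define g where "g = (\<lambda>a. scale_vec (h (a x)) (basis_vec undefined) :: (unit, unit) free_vec)"
  have "lin_ext g (basis_vec (restrict a {x})) \<in> {0}"
    using \<open>basis_vec _ \<in> _\<close>[unfolded tensor_null_def]
  proof (rule lin_ext_span)
    fix r assume "r \<in> multilinear_relations A {x}"
    then show "lin_ext g r \<in> {0}"
      by (cases rule: multilinear_relations_cases)
        (auto simp: lin_ext_diff lin_ext_scale g_def assms(1,2) free_vec.scale_left_distrib)
  qed (rule free_vec.subspace_single_0)
  then have "Poly_Mapping.lookup (g (restrict a {x})) undefined = 0"
    by simp
  then show False
    using assms(3) by (simp add: g_def lookup_basis_vec)
qed


section \<open>C*-algebras as complex algebras\<close>

lemma complex_ring_sel [simp]: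
  "carrier complex_ring = UNIV" "mult complex_ring = (*)" "one complex_ring = 1"
  "zero complex_ring = 0" "add complex_ring = (+)"
  by (simp_all add: complex_ring_def)

context cstar_algebra
begin

text \<open>
  The unqualified names of the ring laws refer to the scalar ring here, since the locale for
  modules is imported after the one for rings.
\<close>

lemma alg_ring: "ring A"
  using cstar_algebra.axioms(1)[OF cstar_algebra_axioms] .

lemmas alg_m_assoc = monoid.m_assoc[OF ring.is_monoid[OF alg_ring]]
lemmas alg_minus_equality = abelian_group.minus_equality[OF ring.is_abelian_group[OF alg_ring]]

lemma scale_closed [simp]: "a \<in> carrier A \<Longrightarrow> c \<odot> a \<in> carrier A"
  using smult_closed[of c a] by simp

lemma scale_scale [simp]: "a \<in> carrier A \<Longrightarrow> c \<odot> (d \<odot> a) = (c * d) \<odot> a"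
  using smult_assoc1[of c d a] by simp

lemma scale_one [simp]: "a \<in> carrier A \<Longrightarrow> 1 \<odot> a = a"
  using smult_one[of a] by simp

lemma scale_zero [simp]: "a \<in> carrier A \<Longrightarrow> 0 \<odot> a = \<zero>"
  using smult_l_null[of a] by simp

lemma scale_add_left: "a \<in> carrier A \<Longrightarrow> (c + d) \<odot> a = c \<odot> a \<oplus> d \<odot> a"
  using smult_l_distr[of c d a] by simp

lemma scale_minus_one:
  assumes "a \<in> carrier A"
  shows "(- 1) \<odot> a = \<ominus> a"
proof -
  have "(- 1) \<odot> a \<oplus> a = \<zero>"
    using scale_add_left[OF assms, of "- 1" 1] assms by simp
  then show ?thesis
    using alg_minus_equality assms scale_closed by metis
qed

text \<open>Distinct scalars would give \<open>(c - d) \<odot> a = \<zero>\<close>, and scaling by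
  the inverse of \<open>c - d\<close> would give \<open>a = \<zero>\<close>. This later separates
  two signs in front of the same nonzero element.\<close>

lemma scale_left_cancel:
  assumes "a \<in> carrier A" "c \<odot> a = d \<odot> a" "a \<noteq> \<zero>"
  shows "c = d"
proof (rule ccontr)
  assume "c \<noteq> d"
  have "(c - d) \<odot> a = c \<odot> a \<oplus> (- d) \<odot> a"
    using scale_add_left[OF assms(1), of c "- d"] by simp
  also have "\<dots> = (d + - d) \<odot> a"
    using scale_add_left[OF assms(1), of d "- d"] assms(2) by simp
  also have "\<dots> = \<zero>"
    using assms(1) by simp
  finally have "(1 / (c - d)) \<odot> ((c - d) \<odot> a) = \<zero>"
    using smult_r_null[of "1 / (c - d)"] by simp
  then show False
    using assms(1,3) \<open>c \<noteq> d\<close> by simp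
qed

lemma foldr_mult_closed:
  "(\<And>y. y \<in> set ys \<Longrightarrow> f y \<in> carrier A) \<Longrightarrow> foldr (\<lambda>y p. f y \<otimes> p) ys \<one> \<in> carrier A"
  by (induction ys) auto

text \<open>Moving \<open>a\<close> past one factor after another collects the scalars
  \<open>g y\<close>. For spin strings they are signs, and their product is the sign of the whole
  exchange.\<close>

lemma foldr_mult_scale_commute:
  assumes "\<And>y. y \<in> set ys \<Longrightarrow> f y \<in> carrier A" "a \<in> carrier A"
    and "\<And>y. y \<in> set ys \<Longrightarrow> f y \<otimes> a = g y \<odot> (a \<otimes> f y)"
  shows "foldr (\<lambda>y p. f y \<otimes> p) ys \<one> \<otimes> a =
    prod_list (map g ys) \<odot> (a \<otimes> foldr (\<lambda>y p. f y \<otimes> p) ys \<one>)"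
  using assms
proof (induction ys)
  case Nil
  then show ?case by simp
next
  case (Cons y ys)
  let ?P = "foldr (\<lambda>y p. f y \<otimes> p) ys \<one>"
  have P: "?P \<in> carrier A"
    using Cons.prems by (intro foldr_mult_closed) auto
  have y: "f y \<in> carrier A" "f y \<otimes> a = g y \<odot> (a \<otimes> f y)"
    using Cons.prems by auto
  have IH: "?P \<otimes> a = prod_list (map g ys) \<odot> (a \<otimes> ?P)"
    using Cons by auto
  have "(f y \<otimes> ?P) \<otimes> a = f y \<otimes> (?P \<otimes> a)"
    using P y Cons.prems(2) by (simp add: alg_m_assoc)
  also have "\<dots> = prod_list (map g ys) \<odot> ((f y \<otimes> a) \<otimes> ?P)"
    unfolding IH using P y(1) Cons.prems(2) by (simp add: smult_mult_right alg_m_assoc)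
  also have "\<dots> = (prod_list (map g ys) * g y) \<odot> (a \<otimes> (f y \<otimes> ?P))"
    unfolding y(2) using P y(1) Cons.prems(2) by (simp add: smult_mult_left alg_m_assoc)
  finally show ?case by (simp add: mult.commute)
qed

lemma foldr_mult_commute:
  assumes "\<And>y. y \<in> set ys \<Longrightarrow> f y \<in> carrier A" "a \<in> carrier A"
    and "\<And>y. y \<in> set ys \<Longrightarrow> f y \<otimes> a = a \<otimes> f y"
  shows "foldr (\<lambda>y p. f y \<otimes> p) ys \<one> \<otimes> a = a \<otimes> foldr (\<lambda>y p. f y \<otimes> p) ys \<one>"
proof -
  have "prod_list (map (\<lambda>_. 1 :: complex) ys) = 1"
    by (induction ys) auto
  then show ?thesis
    using foldr_mult_scale_commute[of ys f a "\<lambda>_. 1"] assms foldr_mult_closed[of ys f] by simp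
qed

text \<open>The factors commute, so the square of the product is the product of the squares.\<close>

lemma foldr_mult_square:
  assumes "\<And>y. y \<in> set ys \<Longrightarrow> f y \<in> carrier A" "\<And>y. y \<in> set ys \<Longrightarrow> f y \<otimes> f y = \<one>"
    and "\<And>y z. y \<in> set ys \<Longrightarrow> z \<in> set ys \<Longrightarrow> f y \<otimes> f z = f z \<otimes> f y"
  shows "foldr (\<lambda>y p. f y \<otimes> p) ys \<one> \<otimes> foldr (\<lambda>y p. f y \<otimes> p) ys \<one> = \<one>"
  using assms
proof (induction ys)
  case Nil
  then show ?case by simp
next
  case (Cons y ys)
  let ?P = "foldr (\<lambda>y p. f y \<otimes> p) ys \<one>"
  have P: "?P \<in> carrier A"
    using Cons.prems by (intro foldr_mult_closed) auto
  have y: "f y \<in> carrier A" "f y \<otimes> f y = \<one>"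
    using Cons.prems by auto
  have comm: "?P \<otimes> f y = f y \<otimes> ?P"
    using Cons.prems by (intro foldr_mult_commute) auto
  have IH: "?P \<otimes> ?P = \<one>"
    using Cons by auto
  have "(f y \<otimes> ?P) \<otimes> (f y \<otimes> ?P) = f y \<otimes> ((?P \<otimes> f y) \<otimes> ?P)"
    using P y(1) by (simp add: alg_m_assoc)
  also have "\<dots> = (f y \<otimes> f y) \<otimes> (?P \<otimes> ?P)"
    unfolding comm using P y(1) by (simp add: alg_m_assoc)
  finally show ?case by (simp add: y(2) IH)
qed

end

section \<open>Homomorphisms and inverses of isomorphisms\<close>

lemma star_homD:
  assumes "star_hom A B h" "a \<in> carrier A"
  shows "h a \<in> carrier B" "h (c \<odot>\<^bsub>A\<^esub> a) = c \<odot>\<^bsub>B\<^esub> h a"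
    "b \<in> carrier A \<Longrightarrow> h (a \<oplus>\<^bsub>A\<^esub> b) = h a \<oplus>\<^bsub>B\<^esub> h b"
    "b \<in> carrier A \<Longrightarrow> h (a \<otimes>\<^bsub>A\<^esub> b) = h a \<otimes>\<^bsub>B\<^esub> h b"
  using assms by (auto simp: star_hom_def)

lemma star_iso_inv_into:
  assumes "cstar_algebra A" "star_iso A B h"
  shows "star_hom B A (inv_into (carrier A) h)"
proof -
  interpret cstar_algebra A by fact
  let ?g = "inv_into (carrier A) h"
  have h: "star_hom A B h" and inj: "inj_on h (carrier A)" and img: "h ` carrier A = carrier B"
    using assms(2) by (auto simp: star_iso_def bij_betw_def)
  have g: "?g b \<in> carrier A" "h (?g b) = b" if "b \<in> carrier B" for b
    using that img by (auto intro: inv_into_into f_inv_into_f)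
  \<comment> \<open>Each law for the inverse is reduced to the corresponding law for
    \<open>h\<close> by exhibiting a preimage.\<close>
  have eqI: "?g b = a" if "a \<in> carrier A" "h a = b" for a b
    using that inj by auto
  have adj: "h (adj A a) = adj B (h a)" if "a \<in> carrier A" for a
    using h that by (simp add: star_hom_def)
  show ?thesis
    unfolding star_hom_def
    by (auto intro!: eqI simp: g adj adj_closed star_homD[OF h])
qed


section \<open>One-site operators in the spin algebra\<close>

text \<open>A name for the anonymous scaling in \<open>complex_mat2\<close>, so that matrix
  identities can be checked entrywise.\<close>

definition cscale :: "complex \<Rightarrow> complex ^ 2 ^ 2 \<Rightarrow> complex ^ 2 ^ 2" where
  "cscale c M = (\<chi> i j. c * M $ i $ j)"

lemma complex_mat2_sel [simp]:
  "carrier complex_mat2 = UNIV" "mult complex_mat2 = (**)" "one complex_mat2 = mat 1"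
  "add complex_mat2 = (+)" "smult complex_mat2 = cscale"
  by (simp_all add: complex_mat2_def cscale_def fun_eq_iff)

lemma mat2_nth [simp]:
  "mat2 a b c d $ 1 $ 1 = a" "mat2 a b c d $ 1 $ 2 = b"
  "mat2 a b c d $ 2 $ 1 = c" "mat2 a b c d $ 2 $ 2 = d"
  by (simp_all add: mat2_def)

lemma cscale_nth [simp]: "cscale c M $ i $ j = c * M $ i $ j"
  by (simp add: cscale_def)

lemma mat2_eq_iff:
  "(M :: 'c ^ 2 ^ 2) = N \<longleftrightarrow> M $ 1 $ 1 = N $ 1 $ 1 \<and> M $ 1 $ 2 = N $ 1 $ 2 \<and>
    M $ 2 $ 1 = N $ 2 $ 1 \<and> M $ 2 $ 2 = N $ 2 $ 2"
  by (auto simp: vec_eq_iff forall_2)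

lemma matrix_mult_nth2:
  "((M :: complex ^ 2 ^ 2) ** N) $ i $ j = M $ i $ 1 * N $ 1 $ j + M $ i $ 2 * N $ 2 $ j"
  by (simp add: matrix_matrix_mult_def sum_2)

lemma mat_one_nth2 [simp]:
  "(mat 1 :: complex ^ 2 ^ 2) $ 1 $ 1 = 1" "(mat 1 :: complex ^ 2 ^ 2) $ 1 $ 2 = 0"
  "(mat 1 :: complex ^ 2 ^ 2) $ 2 $ 1 = 0" "(mat 1 :: complex ^ 2 ^ 2) $ 2 $ 2 = 1"
  by (simp_all add: mat_def)

lemma pauli_nums: "pauli 1 = mat2 0 1 1 0" "pauli 2 = mat2 0 (- \<i>) \<i> 0" "pauli 3 = mat2 1 0 0 (- 1)"
  by (simp_all add: numeral_2_eq_2 numeral_3_eq_3)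

context spin_algebra
begin

sublocale A: cstar_algebra \<AA>
  by (rule cstar)

definition site_op :: "int \<Rightarrow> complex ^ 2 ^ 2 \<Rightarrow> 'b" where
  "site_op x M = inv_into (carrier (site x)) (\<xi> x) M"

text \<open>Allowing an arbitrary matrix instead of only Pauli matrices makes every relation at one
  site a computation with two-by-two matrices.\<close>

definition local_op :: "int \<Rightarrow> complex ^ 2 ^ 2 \<Rightarrow> 'a" where
  "local_op x M = \<phi> {x} (elem_tensor site {x} (\<lambda>y. site_op y M))"

lemma spin_eq: "spin \<kappa> x = local_op x (pauli \<kappa>)"
  by (simp add: spin_def local_op_def site_op_def)

lemma site_op_hom: "star_hom complex_mat2 (site x) (site_op x)"
  using star_iso_inv_into[OF site_cstar site_iso] by (simp add: site_op_def[abs_def])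

lemma site_op_closed [simp]: "site_op x M \<in> carrier (site x)"
  and site_op_mult: "site_op x (M ** N) = site_op x M \<otimes>\<^bsub>site x\<^esub> site_op x N"
  and site_op_add: "site_op x (M + N) = site_op x M \<oplus>\<^bsub>site x\<^esub> site_op x N"
  and site_op_scale: "site_op x (cscale c M) = c \<odot>\<^bsub>site x\<^esub> site_op x M"
  using star_homD[OF site_op_hom] by simp_all

lemma xi_site_op: "\<xi> x (site_op x M) = M"
proof -
  have "\<xi> x ` carrier (site x) = UNIV"
    using site_iso[of x] by (simp add: star_iso_def bij_betw_def)
  then show ?thesis by (simp add: site_op_def f_inv_into_f)
qed

text \<open>A \<open>star_hom\<close> need not be unital. Here the unit of the site algebra has the
  form \<open>site_op x (\<xi> x \<one>)\<close>, so multiplying \<open>site_op x (mat 1)\<close> by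
  it can be evaluated among matrices.\<close>

lemma site_op_one: "site_op x (mat 1) = \<one>\<^bsub>site x\<^esub>"
proof -
  interpret cstar_algebra "site x" by (rule site_cstar)
  have inj: "inj_on (\<xi> x) (carrier (site x))"
    using site_iso[of x] by (auto simp: star_iso_def bij_betw_def)
  have one: "site_op x (\<xi> x \<one>\<^bsub>site x\<^esub>) = \<one>\<^bsub>site x\<^esub>"
    using inj by (simp add: site_op_def)
  have "site_op x (mat 1) = site_op x (mat 1) \<otimes>\<^bsub>site x\<^esub> \<one>\<^bsub>site x\<^esub>"
    by simp
  also have "\<dots> = site_op x (mat 1 ** \<xi> x \<one>\<^bsub>site x\<^esub>)"
    by (simp only: site_op_mult one)
  finally show ?thesis
    by (simp add: one)
qed

lemma phi_hom:
  assumes "finite L" "L \<noteq> {}"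
  shows "X \<in> carrier (tensor_algebra site L) \<Longrightarrow> \<phi> L X \<in> carrier \<AA>"
    and "X \<in> carrier (tensor_algebra site L) \<Longrightarrow>
      \<phi> L (c \<odot>\<^bsub>tensor_algebra site L\<^esub> X) = c \<odot>\<^bsub>\<AA>\<^esub> \<phi> L X"
    and "X \<in> carrier (tensor_algebra site L) \<Longrightarrow> Y \<in> carrier (tensor_algebra site L) \<Longrightarrow>
      \<phi> L (X \<oplus>\<^bsub>tensor_algebra site L\<^esub> Y) = \<phi> L X \<oplus>\<^bsub>\<AA>\<^esub> \<phi> L Y"
    and "X \<in> carrier (tensor_algebra site L) \<Longrightarrow> Y \<in> carrier (tensor_algebra site L) \<Longrightarrow>
      \<phi> L (X \<otimes>\<^bsub>tensor_algebra site L\<^esub> Y) = \<phi> L X \<otimes>\<^bsub>\<AA>\<^esub> \<phi> L Y"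
proof -
  have hom: "star_hom (tensor_algebra site L) (\<AA>\<lparr>carrier := loc L\<rparr>) (\<phi> L)"
    using loc_iso[OF assms] by (simp add: star_iso_def)
  have "loc L \<subseteq> carrier \<AA>"
    using loc_subalgebra[OF assms] by (simp add: cstar_subalgebra_def)
  then show "X \<in> carrier (tensor_algebra site L) \<Longrightarrow> \<phi> L X \<in> carrier \<AA>"
    using star_homD(1)[OF hom] by (auto simp del: tensor_algebra_sel)
qed (use star_homD(2-4)[OF star_iso_def[THEN iffD1, OF loc_iso[OF assms], THEN conjunct1]]
     in \<open>simp_all del: tensor_algebra_sel\<close>)

text \<open>Surjectivity onto \<open>loc L\<close> supplies a preimage \<open>U\<close> of the unit;
  the image of the tensor unit times the image of \<open>U\<close> is the image of their product,
  which is \<open>U\<close> itself.\<close>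

lemma phi_one:
  assumes "finite L" "L \<noteq> {}"
  shows "\<phi> L \<one>\<^bsub>tensor_algebra site L\<^esub> = \<one>\<^bsub>\<AA>\<^esub>"
proof -
  have one: "\<one>\<^bsub>tensor_algebra site L\<^esub> \<in> carrier (tensor_algebra site L)"
    unfolding tensor_algebra_sel(3)
    using site_cstar[THEN cstar_algebra.axioms(1)]
    by (intro elem_tensor_carrier) (simp add: ring.ring_simprules)
  have "\<phi> L ` carrier (tensor_algebra site L) = loc L"
    using loc_iso[OF assms] by (simp add: star_iso_def bij_betw_def)
  then obtain U where U: "U \<in> carrier (tensor_algebra site L)" "\<phi> L U = \<one>\<^bsub>\<AA>\<^esub>"
    using loc_subalgebra[OF assms] by (metis imageE)
  have "\<phi> L \<one>\<^bsub>tensor_algebra site L\<^esub> = \<phi> L \<one>\<^bsub>tensor_algebra site L\<^esub> \<otimes>\<^bsub>\<AA>\<^esub> \<phi> L U"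
    using U(2) phi_hom(1)[OF assms one] by simp
  also have "\<dots> = \<phi> L (\<one>\<^bsub>tensor_algebra site L\<^esub> \<otimes>\<^bsub>tensor_algebra site L\<^esub> U)"
    using phi_hom(4)[OF assms one U(1)] by simp
  also have "\<dots> = \<one>\<^bsub>\<AA>\<^esub>"
    using tensor_l_one[OF site_cstar U(1)] U(2) by simp
  finally show ?thesis .
qed

lemma elem_site_op_carrier:
  "elem_tensor site L (\<lambda>y. site_op y (M y)) \<in> carrier (tensor_algebra site L)"
  by (rule elem_tensor_carrier) simp

lemma local_op_closed [simp]: "local_op x M \<in> carrier \<AA>"
  unfolding local_op_def by (intro phi_hom(1) elem_site_op_carrier) auto

lemma local_op_mult: "local_op x (M ** N) = local_op x M \<otimes>\<^bsub>\<AA>\<^esub> local_op x N"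
proof -
  have "elem_tensor site {x} (\<lambda>y. site_op y (M ** N)) =
      elem_tensor site {x} (\<lambda>y. site_op y M) \<otimes>\<^bsub>tensor_algebra site {x}\<^esub> elem_tensor site {x} (\<lambda>y. site_op y N)"
    by (subst elem_tensor_mult[OF site_cstar]) (simp_all add: site_op_mult)
  then show ?thesis
    unfolding local_op_def
    using phi_hom(4)[OF _ _ elem_site_op_carrier elem_site_op_carrier, of "{x}" "\<lambda>_. M" "\<lambda>_. N"] by simp
qed

text \<open>Links the family of matrices \<open>site_op y M\<close> to the updated tuples
  \<open>a(x := u)\<close> in which multilinearity is phrased.\<close>

lemma elem_tensor_singleton_cong:
  "a x = b x \<Longrightarrow> elem_tensor site {x} a = elem_tensor site {x} b"
  by (simp add: elem_tensor_def restrict_def cong: if_cong)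

lemma local_op_add: "local_op x (M + N) = local_op x M \<oplus>\<^bsub>\<AA>\<^esub> local_op x N"
proof -
  let ?a = "\<lambda>y. site_op y M"
  have "elem_tensor site {x} (?a(x := site_op x M \<oplus>\<^bsub>site x\<^esub> site_op x N)) =
      elem_tensor site {x} (?a(x := site_op x M)) \<oplus>\<^bsub>tensor_algebra site {x}\<^esub>
      elem_tensor site {x} (?a(x := site_op x N))"
    by (rule elem_tensor_add) simp_all
  moreover have "elem_tensor site {x} (?a(x := site_op x K)) = elem_tensor site {x} (\<lambda>y. site_op y K)" for K
    by (rule elem_tensor_singleton_cong) simp
  ultimately have "elem_tensor site {x} (\<lambda>y. site_op y (M + N)) =
      elem_tensor site {x} (\<lambda>y. site_op y M) \<oplus>\<^bsub>tensor_algebra site {x}\<^esub> elem_tensor site {x} (\<lambda>y. site_op y N)"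
    by (simp del: tensor_algebra_sel flip: site_op_add)
  then show ?thesis
    unfolding local_op_def
    using phi_hom(3)[OF _ _ elem_site_op_carrier elem_site_op_carrier, of "{x}" "\<lambda>_. M" "\<lambda>_. N"] by simp
qed

lemma local_op_scale: "local_op x (cscale c M) = c \<odot>\<^bsub>\<AA>\<^esub> local_op x M"
proof -
  let ?a = "\<lambda>y. site_op y M"
  have "elem_tensor site {x} (?a(x := c \<odot>\<^bsub>site x\<^esub> site_op x M)) =
      c \<odot>\<^bsub>tensor_algebra site {x}\<^esub> elem_tensor site {x} (?a(x := site_op x M))"
    by (rule elem_tensor_smult) simp_all
  moreover have "elem_tensor site {x} (?a(x := site_op x K)) = elem_tensor site {x} (\<lambda>y. site_op y K)" for K
    by (rule elem_tensor_singleton_cong) simp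
  ultimately have "elem_tensor site {x} (\<lambda>y. site_op y (cscale c M)) =
      c \<odot>\<^bsub>tensor_algebra site {x}\<^esub> elem_tensor site {x} (\<lambda>y. site_op y M)"
    by (simp del: tensor_algebra_sel flip: site_op_scale)
  then show ?thesis
    unfolding local_op_def
    using phi_hom(2)[OF _ _ elem_site_op_carrier, of "{x}" c "\<lambda>_. M"] by simp
qed

lemma local_op_one: "local_op x (mat 1) = \<one>\<^bsub>\<AA>\<^esub>"
  using phi_one[of "{x}"] by (simp add: local_op_def site_op_one)

text \<open>Compatibility with the embeddings pads the operator with units, so that operators at
  different sites can be multiplied inside one tensor product.\<close>

lemma local_op_extend:
  assumes "finite L" "x \<in> L"
  shows "local_op x M = \<phi> L (elem_tensor site L (\<lambda>y. site_op y (if y = x then M else mat 1)))"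
proof -
  have "local_op x M = \<phi> L (tensor_embed site L {x} (elem_tensor site {x} (\<lambda>y. site_op y M)))"
    unfolding local_op_def using assms
    by (intro compatible[symmetric] elem_site_op_carrier) auto
  also have "tensor_embed site L {x} (elem_tensor site {x} (\<lambda>y. site_op y M)) =
      elem_tensor site L (\<lambda>y. if y \<in> {x} then site_op y M else \<one>\<^bsub>site y\<^esub>)"
    using assms by (intro tensor_embed_elem site_cstar) auto
  also have "(\<lambda>y. if y \<in> {x} then site_op y M else \<one>\<^bsub>site y\<^esub>) =
      (\<lambda>y. site_op y (if y = x then M else mat 1))"
    by (auto simp: site_op_one)
  finally show ?thesis .
qed

text \<open>Over \<open>{x, y}\<close> at least one of the two matrices in each slot is the
  identity, so the slotwise products agree in both orders.\<close>

lemma local_op_commute: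
  assumes "x \<noteq> y"
  shows "local_op x M \<otimes>\<^bsub>\<AA>\<^esub> local_op y N = local_op y N \<otimes>\<^bsub>\<AA>\<^esub> local_op x M"
proof -
  let ?E = "\<lambda>w M. elem_tensor site {x, y} (\<lambda>z. site_op z (if z = w then M else mat 1))"
  have eq: "local_op x M = \<phi> {x, y} (?E x M)" "local_op y N = \<phi> {x, y} (?E y N)"
    by (rule local_op_extend; simp)+
  have mult: "?E w K \<otimes>\<^bsub>tensor_algebra site {x, y}\<^esub> ?E w' K' = elem_tensor site {x, y}
      (\<lambda>z. site_op z ((if z = w then K else mat 1) ** (if z = w' then K' else mat 1)))" for w w' K K'
    by (simp only: elem_tensor_mult[OF site_cstar site_op_closed site_op_closed] site_op_mult)
  have "(if z = x then M else mat 1) ** (if z = y then N else mat 1) =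
      (if z = y then N else mat 1) ** (if z = x then M else mat 1)" for z
    using assms by simp
  then have "?E x M \<otimes>\<^bsub>tensor_algebra site {x, y}\<^esub> ?E y N =
      ?E y N \<otimes>\<^bsub>tensor_algebra site {x, y}\<^esub> ?E x M"
    by (simp only: mult)
  moreover have phi: "\<phi> {x, y} (?E w K \<otimes>\<^bsub>tensor_algebra site {x, y}\<^esub> ?E w' K') =
      \<phi> {x, y} (?E w K) \<otimes>\<^bsub>\<AA>\<^esub> \<phi> {x, y} (?E w' K')" for w w' K K'
    by (rule phi_hom(4)[OF _ _ elem_site_op_carrier elem_site_op_carrier]) auto
  ultimately show ?thesis
    by (simp only: eq phi[symmetric])
qed

lemma one_neq_zero: "\<one>\<^bsub>\<AA>\<^esub> \<noteq> \<zero>\<^bsub>\<AA>\<^esub>"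
proof
  assume *: "\<one>\<^bsub>\<AA>\<^esub> = \<zero>\<^bsub>\<AA>\<^esub>"
  let ?T = "tensor_algebra site {0}"
  \<comment> \<open>If the unit were zero the algebra would collapse, and the injective
    \<open>\<phi> {0}\<close> could not separate the unit tensor from the zero coset.\<close>
  have triv: "a = \<zero>\<^bsub>\<AA>\<^esub>" if "a \<in> carrier \<AA>" for a
  proof -
    have "\<one>\<^bsub>\<AA>\<^esub> \<otimes>\<^bsub>\<AA>\<^esub> a = a" "\<zero>\<^bsub>\<AA>\<^esub> \<otimes>\<^bsub>\<AA>\<^esub> a = \<zero>\<^bsub>\<AA>\<^esub>"
      using that by simp_all
    then show ?thesis using * by simp
  qed
  have inj: "inj_on (\<phi> {0}) (carrier ?T)"
    using loc_iso[of "{0}"] by (simp add: star_iso_def bij_betw_def)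
  have E: "elem_tensor site {0} (\<lambda>y. site_op y (mat 1)) \<in> carrier ?T"
    by (rule elem_site_op_carrier)
  moreover have Z: "tensor_class site {0} 0 \<in> carrier ?T"
    unfolding tensor_algebra_sel(1) by (intro imageI) simp
  moreover have "\<phi> {0} (elem_tensor site {0} (\<lambda>y. site_op y (mat 1))) = \<phi> {0} (tensor_class site {0} 0)"
    using triv[OF phi_hom(1)[OF _ _ E]] triv[OF phi_hom(1)[OF _ _ Z]] by simp
  ultimately have "elem_tensor site {0} (\<lambda>y. site_op y (mat 1)) = tensor_class site {0} 0"
    using inj by (auto dest: inj_onD simp del: tensor_algebra_sel)
  moreover have "star_hom (site 0) complex_mat2 (\<xi> 0)"
    using site_iso[of 0] by (simp add: star_iso_def)
  \<comment> \<open>The functional is the upper left matrix entry, which equals 1 at the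
    identity.\<close>
  then have "elem_tensor site {0} (\<lambda>y. site_op y (mat 1)) \<noteq> tensor_class site {0} 0"
    by (intro elem_tensor_singleton_neq_0[of site 0 "\<lambda>u. \<xi> 0 u $ 1 $ 1"])
      (simp_all add: star_homD xi_site_op)
  ultimately show False by simp
qed
end


section \<open>Spin strings\<close>

context spin_algebra
begin

lemma spin_zero: "spin 0 x = \<one>\<^bsub>\<AA>\<^esub>"
  by (simp add: spin_eq local_op_one)

lemma spin_closed [simp]: "spin \<kappa> x \<in> carrier \<AA>"
  by (simp add: spin_eq)

lemma spin_minus_eq: "spin_minus x = local_op x (mat2 0 0 1 0)"
proof -
  \<comment> \<open>With the ring negative absorbed into a scalar, the whole expression is the image
    of one matrix.\<close>
  have "\<ominus>\<^bsub>\<AA>\<^esub> (\<i> \<odot>\<^bsub>\<AA>\<^esub> spin 2 x) = (- \<i>) \<odot>\<^bsub>\<AA>\<^esub> spin 2 x"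
    using A.scale_minus_one[of "\<i> \<odot>\<^bsub>\<AA>\<^esub> spin 2 x"] by simp
  then have "spin_minus x = local_op x (cscale (1 / 2) (pauli 1 + cscale (- \<i>) (pauli 2)))"
    by (simp only: spin_minus_def a_minus_def local_op_scale local_op_add spin_eq)
  also have "cscale (1 / 2) (pauli 1 + cscale (- \<i>) (pauli 2)) = mat2 0 0 1 0"
    by (simp add: mat2_eq_iff pauli_nums)
  finally show ?thesis .
qed

lemma spin_minus_closed [simp]: "spin_minus x \<in> carrier \<AA>"
  by (simp add: spin_minus_eq)

lemma spin_commute:
  "spin 3 x \<otimes>\<^bsub>\<AA>\<^esub> spin 3 y = spin 3 y \<otimes>\<^bsub>\<AA>\<^esub> spin 3 x"
  by (cases "x = y") (simp_all add: spin_eq local_op_commute)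

lemma spin_3_square: "spin 3 x \<otimes>\<^bsub>\<AA>\<^esub> spin 3 x = \<one>\<^bsub>\<AA>\<^esub>"
proof -
  have "pauli 3 ** pauli 3 = mat 1"
    by (simp add: mat2_eq_iff pauli_nums matrix_mult_nth2)
  then show ?thesis
    by (simp add: spin_eq local_op_one flip: local_op_mult)
qed

text \<open>The two matrices anticommute at a common site, and operators at distinct sites commute.
  Writing both cases with a scalar fits \<open>foldr_mult_scale_commute\<close>.\<close>

lemma spin_3_minus:
  "spin 3 x \<otimes>\<^bsub>\<AA>\<^esub> spin_minus y =
    (if x = y then - 1 else 1) \<odot>\<^bsub>\<AA>\<^esub> (spin_minus y \<otimes>\<^bsub>\<AA>\<^esub> spin 3 x)"
proof (cases "x = y")
  case True
  have "pauli 3 ** mat2 0 0 1 0 = cscale (- 1) (mat2 0 0 1 0 ** pauli 3)"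
    by (simp add: mat2_eq_iff pauli_nums matrix_mult_nth2)
  then have "local_op x (pauli 3) \<otimes>\<^bsub>\<AA>\<^esub> local_op x (mat2 0 0 1 0) =
      (- 1) \<odot>\<^bsub>\<AA>\<^esub> (local_op x (mat2 0 0 1 0) \<otimes>\<^bsub>\<AA>\<^esub> local_op x (pauli 3))"
    by (simp only: local_op_scale flip: local_op_mult)
  with True show ?thesis
    by (simp only: spin_eq spin_minus_eq simp_thms if_True)
qed (simp add: spin_eq spin_minus_eq local_op_commute)

lemma spin_minus_neq_zero: "spin_minus x \<otimes>\<^bsub>\<AA>\<^esub> spin_minus y \<noteq> \<zero>\<^bsub>\<AA>\<^esub>" if "x \<noteq> y"
proof
  assume zero: "spin_minus x \<otimes>\<^bsub>\<AA>\<^esub> spin_minus y = \<zero>\<^bsub>\<AA>\<^esub>"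
  \<comment> \<open>The raising operator at the given site.\<close>
  define p where "p = (\<lambda>x. local_op x (mat2 0 1 0 0))"
  have p: "p z \<in> carrier \<AA>" for z
    by (simp add: p_def)
  have "mat2 0 1 0 0 ** mat2 0 0 1 0 + mat2 0 0 1 0 ** mat2 0 1 0 0 = (mat 1 :: complex ^ 2 ^ 2)"
    by (simp add: mat2_eq_iff matrix_mult_nth2)
  then have one: "p z \<otimes>\<^bsub>\<AA>\<^esub> spin_minus z \<oplus>\<^bsub>\<AA>\<^esub> spin_minus z \<otimes>\<^bsub>\<AA>\<^esub> p z = \<one>\<^bsub>\<AA>\<^esub>" for z
    unfolding p_def spin_minus_eq
    by (metis local_op_mult local_op_add local_op_one)
  \<comment> \<open>Inserting the unit at \<open>x\<close> and moving \<open>p x\<close> past the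
    operator at \<open>y\<close> makes the vanishing product appear in both summands.\<close>
  have "spin_minus y = (p x \<otimes>\<^bsub>\<AA>\<^esub> spin_minus x \<oplus>\<^bsub>\<AA>\<^esub> spin_minus x \<otimes>\<^bsub>\<AA>\<^esub> p x) \<otimes>\<^bsub>\<AA>\<^esub> spin_minus y"
    by (simp add: one)
  also have "\<dots> = p x \<otimes>\<^bsub>\<AA>\<^esub> (spin_minus x \<otimes>\<^bsub>\<AA>\<^esub> spin_minus y) \<oplus>\<^bsub>\<AA>\<^esub>
      spin_minus x \<otimes>\<^bsub>\<AA>\<^esub> (p x \<otimes>\<^bsub>\<AA>\<^esub> spin_minus y)"
    using p by (simp add: A.alg_m_assoc ring.ring_simprules(13)[OF A.alg_ring])
  also have "p x \<otimes>\<^bsub>\<AA>\<^esub> spin_minus y = spin_minus y \<otimes>\<^bsub>\<AA>\<^esub> p x"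
    using that by (simp only: p_def spin_minus_eq local_op_commute)
  also have "spin_minus x \<otimes>\<^bsub>\<AA>\<^esub> (spin_minus y \<otimes>\<^bsub>\<AA>\<^esub> p x) = (spin_minus x \<otimes>\<^bsub>\<AA>\<^esub> spin_minus y) \<otimes>\<^bsub>\<AA>\<^esub> p x"
    using p by (simp add: A.alg_m_assoc)
  finally have "spin_minus y = \<zero>\<^bsub>\<AA>\<^esub>"
    using p[of x] by (simp add: zero)
  \<comment> \<open>The same decomposition of the unit at \<open>y\<close> now has two vanishing
    summands.\<close>
  then have "\<one>\<^bsub>\<AA>\<^esub> = \<zero>\<^bsub>\<AA>\<^esub>"
    using one[of y] p[of y] by simp
  then show False
    using one_neq_zero by simp
qed

section \<open>Strings and the signs they produce\<close>

abbreviation sites_before :: "int \<Rightarrow> int list" where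
  "sites_before x \<equiv> (if x \<ge> 1 then [1..x - 1] else [x..0])"

lemma string_op_closed [simp]: "string_op x \<in> carrier \<AA>"
  unfolding string_op_def by (rule A.foldr_mult_closed) simp

lemma string_op_commute: "string_op x \<otimes>\<^bsub>\<AA>\<^esub> string_op y = string_op y \<otimes>\<^bsub>\<AA>\<^esub> string_op x"
proof -
  \<comment> \<open>Commutation is applied twice: one string passes a single spin, and then the
    other string passes the first.\<close>
  have "string_op y \<otimes>\<^bsub>\<AA>\<^esub> spin 3 z = spin 3 z \<otimes>\<^bsub>\<AA>\<^esub> string_op y" for z
    unfolding string_op_def by (rule A.foldr_mult_commute) (simp_all add: spin_commute)
  then show ?thesis
    unfolding string_op_def[of x]
    by (intro A.foldr_mult_commute string_op_closed spin_closed) simp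
qed

lemma string_op_square: "string_op x \<otimes>\<^bsub>\<AA>\<^esub> string_op x = \<one>\<^bsub>\<AA>\<^esub>"
  unfolding string_op_def by (rule A.foldr_mult_square) (simp_all add: spin_3_square spin_commute)

definition string_sign :: "int \<Rightarrow> int \<Rightarrow> complex" where
  "string_sign y x = (if x \<in> set (sites_before y) then - 1 else 1)"

lemma string_op_spin_minus:
  "string_op y \<otimes>\<^bsub>\<AA>\<^esub> spin_minus x = string_sign y x \<odot>\<^bsub>\<AA>\<^esub> (spin_minus x \<otimes>\<^bsub>\<AA>\<^esub> string_op y)"
proof -
  \<comment> \<open>A list without repetitions meets \<open>x\<close> at most once, so at most one
    factor is -1.\<close>
  have sign: "prod_list (map (\<lambda>z. if z = x then - 1 else 1) zs) = (if x \<in> set zs then - 1 else 1 :: complex)"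
    if "distinct zs" for zs
    using that by (induction zs) auto
  have "distinct (sites_before y)"
    by simp
  then show ?thesis
    unfolding string_op_def string_sign_def sign[symmetric, OF \<open>distinct (sites_before y)\<close>]
    by (intro A.foldr_mult_scale_commute spin_closed spin_minus_closed spin_3_minus)
qed

definition ladder :: "int \<Rightarrow> 'a" where
  "ladder x = string_op x \<otimes>\<^bsub>\<AA>\<^esub> spin_minus x"

text \<open>A normal form with the strings in front: the products of two ladder operators in either
  order are scalar multiples of this one element.\<close>

definition ladder_pair :: "int \<Rightarrow> int \<Rightarrow> 'a" where
  "ladder_pair x y = (string_op x \<otimes>\<^bsub>\<AA>\<^esub> string_op y) \<otimes>\<^bsub>\<AA>\<^esub> (spin_minus x \<otimes>\<^bsub>\<AA>\<^esub> spin_minus y)"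

lemma ladder_closed [simp]: "ladder x \<in> carrier \<AA>" "ladder_pair x y \<in> carrier \<AA>"
  by (simp_all add: ladder_def ladder_pair_def)

lemma ladder_mult: "ladder x \<otimes>\<^bsub>\<AA>\<^esub> ladder y = string_sign y x \<odot>\<^bsub>\<AA>\<^esub> ladder_pair x y"
proof -
  \<comment> \<open>The sign squares to 1, so the exchange relation can be solved for the opposite
    order.\<close>
  have "string_sign y x \<odot>\<^bsub>\<AA>\<^esub> (string_op y \<otimes>\<^bsub>\<AA>\<^esub> spin_minus x) = spin_minus x \<otimes>\<^bsub>\<AA>\<^esub> string_op y"
    unfolding string_op_spin_minus by (simp add: string_sign_def)
  then have comm: "spin_minus x \<otimes>\<^bsub>\<AA>\<^esub> string_op y = string_sign y x \<odot>\<^bsub>\<AA>\<^esub> (string_op y \<otimes>\<^bsub>\<AA>\<^esub> spin_minus x)" ..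
  have "ladder x \<otimes>\<^bsub>\<AA>\<^esub> ladder y =
      string_op x \<otimes>\<^bsub>\<AA>\<^esub> ((spin_minus x \<otimes>\<^bsub>\<AA>\<^esub> string_op y) \<otimes>\<^bsub>\<AA>\<^esub> spin_minus y)"
    by (simp add: ladder_def A.alg_m_assoc)
  then show ?thesis
    unfolding comm by (simp add: A.smult_mult_left A.smult_mult_right ladder_pair_def A.alg_m_assoc)
qed

lemma ladder_pair_commute: "x \<noteq> y \<Longrightarrow> ladder_pair x y = ladder_pair y x"
  unfolding ladder_pair_def string_op_commute[of x y] spin_minus_eq
  by (simp only: local_op_commute)

lemma ladder_pair_neq_zero:
  assumes "x \<noteq> y"
  shows "ladder_pair x y \<noteq> \<zero>\<^bsub>\<AA>\<^esub>"
proof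
  assume zero: "ladder_pair x y = \<zero>\<^bsub>\<AA>\<^esub>"
  let ?m = "spin_minus x \<otimes>\<^bsub>\<AA>\<^esub> spin_minus y"
  \<comment> \<open>Multiplying from the left first by the string of \<open>x\<close> and then by
    that of \<open>y\<close> strips both strings.\<close>
  have "string_op y \<otimes>\<^bsub>\<AA>\<^esub> (string_op x \<otimes>\<^bsub>\<AA>\<^esub> ladder_pair x y) =
      string_op y \<otimes>\<^bsub>\<AA>\<^esub> (((string_op x \<otimes>\<^bsub>\<AA>\<^esub> string_op x) \<otimes>\<^bsub>\<AA>\<^esub> string_op y) \<otimes>\<^bsub>\<AA>\<^esub> ?m)"
    by (simp add: ladder_pair_def A.alg_m_assoc)
  also have "\<dots> = (string_op y \<otimes>\<^bsub>\<AA>\<^esub> string_op y) \<otimes>\<^bsub>\<AA>\<^esub> ?m"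
    by (simp add: string_op_square[of x] A.alg_m_assoc)
  also have "\<dots> = ?m"
    by (simp add: string_op_square)
  finally show False
    using spin_minus_neq_zero[OF assms] by (simp add: zero)
qed

end


section \<open>The annihilation operators\<close>

context spin_extension
begin

text \<open>The eigenvalue of \<open>\<Theta>\<close> on the lowering operator at
  \<open>x\<close>.\<close>

definition side_sign :: "int \<Rightarrow> complex" where
  "side_sign x = (if x \<ge> 1 then 1 else - 1)"

lemma theta_hom: "star_hom \<AA> \<AA> \<Theta>"
  using \<Theta>_iso by (simp add: star_iso_def)

text \<open>The unit is the spin of index 0 at site 1, where \<open>\<Theta>\<close> fixes all
  spins.\<close>

lemma theta_one: "\<Theta> \<one>\<^bsub>\<AA>\<^esub> = \<one>\<^bsub>\<AA>\<^esub>"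
  using \<Theta>_right[of 0 1] by (simp add: spin_zero)

lemma theta_spin_3: "\<Theta> (spin 3 x) = spin 3 x"
  using \<Theta>_right[of 3 x] \<Theta>_left[of 3 x] by (cases "x \<ge> 1") simp_all

lemma theta_spin_off_diagonal:
  "\<kappa> \<in> {1, 2} \<Longrightarrow> \<Theta> (spin \<kappa> x) = side_sign x \<odot>\<^bsub>\<AA>\<^esub> spin \<kappa> x"
  using \<Theta>_right[of \<kappa> x] \<Theta>_left[of \<kappa> x] by (cases "x \<ge> 1") (auto simp: side_sign_def)

lemma theta_spin_minus: "\<Theta> (spin_minus x) = side_sign x \<odot>\<^bsub>\<AA>\<^esub> spin_minus x"
proof -
  let ?M = "cscale (1 / 2) (pauli 1 + cscale (- \<i>) (pauli 2))"
  have M: "mat2 0 0 1 0 = ?M"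
    by (simp add: mat2_eq_iff pauli_nums)
  have spin: "spin_minus x = (1 / 2) \<odot>\<^bsub>\<AA>\<^esub> (spin 1 x \<oplus>\<^bsub>\<AA>\<^esub> (- \<i>) \<odot>\<^bsub>\<AA>\<^esub> spin 2 x)"
    by (simp only: spin_minus_eq M local_op_scale local_op_add spin_eq)
  have theta: "\<Theta> (spin 1 x) = side_sign x \<odot>\<^bsub>\<AA>\<^esub> spin 1 x" "\<Theta> (spin 2 x) = side_sign x \<odot>\<^bsub>\<AA>\<^esub> spin 2 x"
    by (rule theta_spin_off_diagonal; simp)+
  \<comment> \<open>Both off-diagonal Pauli operators acquire the same sign, which therefore factors
    out of their combination.\<close>
  have "\<Theta> (spin_minus x) = (1 / 2) \<odot>\<^bsub>\<AA>\<^esub> (\<Theta> (spin 1 x) \<oplus>\<^bsub>\<AA>\<^esub> (- \<i>) \<odot>\<^bsub>\<AA>\<^esub> \<Theta> (spin 2 x))"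
    unfolding spin by (simp add: star_homD[OF theta_hom])
  also have "\<dots> = local_op x (cscale (1 / 2)
      (cscale (side_sign x) (pauli 1) + cscale (- \<i>) (cscale (side_sign x) (pauli 2))))"
    unfolding theta by (simp only: spin_eq local_op_scale local_op_add)
  also have "cscale (1 / 2) (cscale (side_sign x) (pauli 1) +
      cscale (- \<i>) (cscale (side_sign x) (pauli 2))) = cscale (side_sign x) (mat2 0 0 1 0)"
    by (simp add: mat2_eq_iff pauli_nums side_sign_def)
  finally show ?thesis
    by (simp only: spin_minus_eq local_op_scale)
qed

lemma theta_string_op: "\<Theta> (string_op x) = string_op x"
proof -
  let ?P = "\<lambda>ys. foldr (\<lambda>y p. spin 3 y \<otimes>\<^bsub>\<AA>\<^esub> p) ys \<one>\<^bsub>\<AA>\<^esub>"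
  have "\<Theta> (?P ys) = ?P ys" for ys
  proof (induction ys)
    case (Cons y ys)
    have "?P ys \<in> carrier \<AA>"
      by (rule A.foldr_mult_closed) simp
    with Cons show ?case
      by (simp add: star_homD(4)[OF theta_hom] theta_spin_3)
  qed (simp add: theta_one)
  then show ?thesis
    by (simp only: string_op_def)
qed

lemma theta_ladder: "\<Theta> (ladder x) = side_sign x \<odot>\<^bsub>\<AA>\<^esub> ladder x"
  by (simp add: ladder_def star_homD(4)[OF theta_hom] theta_string_op theta_spin_minus A.smult_mult_right)

lemma hat_mult:
  "M \<otimes>\<^bsub>hat_algebra\<^esub> N =
    (\<chi> i j. M $ i $ 1 \<otimes>\<^bsub>\<AA>\<^esub> N $ 1 $ j \<oplus>\<^bsub>\<AA>\<^esub> M $ i $ 2 \<otimes>\<^bsub>\<AA>\<^esub> N $ 2 $ j)"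
  by (simp add: hat_algebra_def mat2_over_def with_cstar_norm_def)

text \<open>Left multiplication by \<open>T\<close> swaps the rows of a diagonal matrix.\<close>

lemma annih_eq: "annih x = mat2 \<zero>\<^bsub>\<AA>\<^esub> (\<Theta> (ladder x)) (ladder x) \<zero>\<^bsub>\<AA>\<^esub>"
proof -
  have "\<Theta> (ladder x) \<in> carrier \<AA>"
    using star_homD(1)[OF theta_hom] by simp
  then show ?thesis
    unfolding annih_def T_def \<psi>_def hat_mult ladder_def[symmetric]
    by (simp add: mat2_eq_iff)
qed

text \<open>The entry is \<open>\<Theta> (ladder x)\<close> times \<open>ladder y\<close>:
  \<open>\<Theta>\<close> contributes the side sign of \<open>x\<close>, the normal form the string
  sign.\<close>

lemma annih_mult_entry:
  "(annih x \<otimes>\<^bsub>hat_algebra\<^esub> annih y) $ 1 $ 1 =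
    (side_sign x * string_sign y x) \<odot>\<^bsub>\<AA>\<^esub> ladder_pair x y"
  by (simp add: hat_mult annih_eq theta_ladder A.smult_mult_left ladder_mult)

text \<open>On one side of the origin the side signs agree and exactly one of the two strings passes
  the other site. On opposite sides neither string reaches the other site, but the side signs
  differ.\<close>

lemma sign_anticommute:
  assumes "x \<noteq> y"
  shows "side_sign x * string_sign y x \<noteq> side_sign y * string_sign x y"
  using assms by (auto simp: side_sign_def string_sign_def)

text \<open>The upper left entries of the two products are different multiples of the same nonzero
  \<open>ladder_pair\<close>.\<close>

lemma annih_not_commute:
  assumes "x \<noteq> y"
  shows "annih x \<otimes>\<^bsub>hat_algebra\<^esub> annih y \<noteq> annih y \<otimes>\<^bsub>hat_algebra\<^esub> annih x"
proof
  assume "annih x \<otimes>\<^bsub>hat_algebra\<^esub> annih y = annih y \<otimes>\<^bsub>hat_algebra\<^esub> annih x"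
  then have "(side_sign x * string_sign y x) \<odot>\<^bsub>\<AA>\<^esub> ladder_pair x y =
      (side_sign y * string_sign x y) \<odot>\<^bsub>\<AA>\<^esub> ladder_pair x y"
    using annih_mult_entry[of x y] annih_mult_entry[of y x] ladder_pair_commute[OF assms] by simp
  then have "side_sign x * string_sign y x = side_sign y * string_sign x y"
    by (rule A.scale_left_cancel[rotated]) (simp_all add: ladder_pair_neq_zero assms)
  then show False
    using sign_anticommute[OF assms] by simp
qed

lemma no_spin_hom:
  assumes "star_hom \<AA> hat_algebra1 F" "x \<noteq> y"
    "F (spin_minus x) = annih x" "F (spin_minus y) = annih y"
  shows False
proof -
  \<comment> \<open>Passing to the generated subalgebra changes only the carrier.\<close>
  have mult: "mult hat_algebra1 = mult hat_algebra"
    by (simp add: hat_algebra1_def)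
  have "F (spin_minus x \<otimes>\<^bsub>\<AA>\<^esub> spin_minus y) = annih x \<otimes>\<^bsub>hat_algebra\<^esub> annih y"
    "F (spin_minus y \<otimes>\<^bsub>\<AA>\<^esub> spin_minus x) = annih y \<otimes>\<^bsub>hat_algebra\<^esub> annih x"
    using star_homD(4)[OF assms(1)] assms(3,4) by (simp_all add: mult)
  moreover have "spin_minus x \<otimes>\<^bsub>\<AA>\<^esub> spin_minus y = spin_minus y \<otimes>\<^bsub>\<AA>\<^esub> spin_minus x"
    using assms(2) by (simp only: spin_minus_eq local_op_commute)
  ultimately show False
    using annih_not_commute[OF assms(2)] by simp
qed

end

theorem proposition44:
  fixes site :: "int \<Rightarrow> 'b cstar"
    and \<xi> :: "int \<Rightarrow> 'b \<Rightarrow> complex ^ 2 ^ 2"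
    and \<AA> :: "'a cstar"
    and loc :: "int set \<Rightarrow> 'a set"
    and \<phi> :: "int set \<Rightarrow> (int, 'b) free_vec set \<Rightarrow> 'a"
    and \<Theta> :: "'a \<Rightarrow> 'a"
  assumes "spin_extension site \<xi> \<AA> loc \<phi> \<Theta>"
  shows "\<not> (\<exists>F. star_hom \<AA> (spin_extension.hat_algebra1 site \<xi> \<AA> \<phi> \<Theta>) F \<and>
           (\<exists>x y. x \<noteq> y \<and>
              F (spin_algebra.spin_minus site \<xi> \<AA> \<phi> x) =
                spin_extension.annih site \<xi> \<AA> \<phi> \<Theta> x \<and>
              F (spin_algebra.spin_minus site \<xi> \<AA> \<phi> y) =
                spin_extension.annih site \<xi> \<AA> \<phi> \<Theta> y))"
  using spin_extension.no_spin_hom[OF assms] by blast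

end
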